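(* Let $m,n\ge 1$ be integers, and let $(X_t)_{t\ge 0}$ be a Laguerre process $L(n,m,x_0)$ of dimension $n$ and size $m$. Write a Hermitian matrix as $x+iy$ with $x=(x_{jk})$ real symmetric and $y=(y_{jk})$ real skew-symmetric. On functions $f$ of class $C^2$ of the entries $(x_{jk}),(y_{jk})$ satisfying $$\frac{\partial f}{\partial x_{ij}}=\frac{\partial f}{\partial x_{ji}},\qquad \frac{\partial f}{\partial y_{ij}}=-\frac{\partial f}{\partial y_{ji}}\qquad\text{for all } i,j,$$ the infinitesimal generator of $(X_t)_{t\ge0}$ is given by $$\mathscr{L}=2n\,\mathrm{tr}\Big(\Re\Big(\frac{\partial}{\partial z}\Big)\Big)+2\Big[\mathrm{tr}\Big(x\,\Re\Big(\frac{\partial}{\partial z}\Big)^2\Big)+\mathrm{tr}\Big(y\,\Im\Big(\frac{\partial}{\partial z}\Big)^2\Big)\Big].$$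
   Context: Laguerre process $L(n,m,x_0)$: $X_t=B_t^{\star}B_t$, where $B$ is an $n\times m$ complex Brownian matrix with $x_0=B_0^\star B_0$, i.e. $B=B^1+iB^2$ with $B^1,B^2$ independent real $n\times m$ matrices whose entries are independent standard real Brownian motions (so each entry $\gamma$ satisfies $d\langle\gamma,\gamma\rangle_t=0$, $d\langle\gamma,\overline\gamma\rangle_t=2\,dt$). It satisfies $dX_t=dB_t^\star B_t+B_t^\star dB_t+2nI_m\,dt$. Matrix-valued differential operators (all entries $x_{jk}$, $y_{jk}$, $1\le j,k\le m$, are treated as separate variables when differentiating): $\frac{\partial}{\partial x}=(\frac{\partial}{\partial x_{jk}})_{j,k}$, $\frac{\partial}{\partial y}=(\frac{\partial}{\partial y_{jk}})_{j,k}$, $\frac{\partial}{\partial z}=(\frac{\partial}{\partial x_{jk}}-i\frac{\partial}{\partial y_{jk}})_{j,k}$. Products are matrix products of operators: $\big(\frac{\partial}{\partial z}\big)^2_{ij}=\sum_k\frac{\partial^2}{\partial z_{ik}\partial z_{kj}}$ with $\frac{\partial}{\partial z_{jk}}=\frac{\partial}{\partial x_{jk}}-i\frac{\partial}{\partial y_{jk}}$, and $\big(\frac{\partial}{\partial x}\frac{\partial}{\partial y}\big)_{ij}=\sum_k\frac{\partial^2}{\partial x_{ik}\partial y_{kj}}$. Real and imaginary parts are taken formally, treating $\frac{\partial}{\partial x_{jk}},\frac{\partial}{\partial y_{jk}}$ as real: $\Re(\frac{\partial}{\partial z})=\frac{\partial}{\partial x}$, $\Re(\frac{\partial}{\partial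 z})^2=(\frac{\partial}{\partial x})^2-(\frac{\partial}{\partial y})^2$, $\Im(\frac{\partial}{\partial z})^2=-\big(\frac{\partial}{\partial x}\frac{\partial}{\partial y}+\frac{\partial}{\partial y}\frac{\partial}{\partial x}\big)$.
   Formalization: The generator is the pointwise limit of (E f(X_t) − f(x_0))/t, and f is additionally assumed to have f(X_t) integrable for all small t > 0, since for C² functions of very fast growth such as exp((tr x)²) this expectation is infinite. *)

theory Defs
  imports "HOL-Probability.Probability"
begin

section \<open>Complex Brownian matrices and Laguerre processes\<close>

text \<open>
  Real Brownian motion with unit variance parameter, indexed by the times \<open>t \<ge> 0\<close> (values at
  negative times are irrelevant) and started at the deterministic point \<open>b\<close>.
\<close>

definition brownian_motion :: "'w measure \<Rightarrow> real \<Rightarrow> (real \<Rightarrow> 'w \<Rightarrow> real) \<Rightarrow> bool" where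
  "brownian_motion M b W \<longleftrightarrow>
     prob_space M \<and>
     (\<forall>t\<ge>0. W t \<in> borel_measurable M) \<and>
     (AE \<omega> in M. W 0 \<omega> = b) \<and>
     (AE \<omega> in M. continuous_on {0..} (\<lambda>t. W t \<omega>)) \<and>
     (\<forall>s t. 0 \<le> s \<longrightarrow> s < t \<longrightarrow>
        distributed M lborel (\<lambda>\<omega>. W t \<omega> - W s \<omega>) (normal_density 0 (sqrt (t - s)))) \<and>
     (\<forall>(k::nat) (\<tau>::nat \<Rightarrow> real). 0 \<le> \<tau> 0 \<longrightarrow> mono \<tau> \<longrightarrow>
        prob_space.indep_vars M (\<lambda>_. borel) (\<lambda>i \<omega>. W (\<tau> (Suc i)) \<omega> - W (\<tau> i) \<omega>) {..<k})"

text \<open>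
  The type \<open>complex^'m^'n\<close> consists of the matrices with rows indexed by \<open>'n\<close> and columns
  indexed by \<open>'m\<close>. The real processes attached to \<open>B\<close> are indexed by \<open>(j, k, c)\<close>, where \<open>c\<close>
  selects the real part (\<open>B\<^sup>1\<close>) or the imaginary part (\<open>B\<^sup>2\<close>) of the entry \<open>(j, k)\<close>.
\<close>

definition real_entry :: "(real \<Rightarrow> 'w \<Rightarrow> complex^'m^'n) \<Rightarrow> 'n \<times> 'm \<times> bool \<Rightarrow> real \<Rightarrow> 'w \<Rightarrow> real" where
  "real_entry B = (\<lambda>(j, k, c) t \<omega>. if c then Re (B t \<omega> $ j $ k) else Im (B t \<omega> $ j $ k))"

text \<open>
  The entries are independent as processes: each one is a random variable with values in the
  product space of all real functions on the time axis.
\<close>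

definition complex_brownian_matrix ::
    "'w measure \<Rightarrow> complex^'m^'n \<Rightarrow> (real \<Rightarrow> 'w \<Rightarrow> complex^'m^'n) \<Rightarrow> bool" where
  "complex_brownian_matrix M b B \<longleftrightarrow>
     prob_space M \<and>
     (\<forall>j k. brownian_motion M (Re (b $ j $ k)) (real_entry B (j, k, True))) \<and>
     (\<forall>j k. brownian_motion M (Im (b $ j $ k)) (real_entry B (j, k, False))) \<and>
     prob_space.indep_vars M (\<lambda>_. Pi\<^sub>M {0..} (\<lambda>_. borel))
       (\<lambda>e \<omega>. restrict (\<lambda>t. real_entry B e t \<omega>) {0..}) UNIV"

definition conj_transpose :: "complex^'m^'n \<Rightarrow> complex^'n^'m" where
  "conj_transpose A = (\<chi> i j. cnj (A $ j $ i))"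

text \<open>
  \<open>X\<close> is the process \<open>L(n, m, x\<^sub>0)\<close> built from the Brownian matrix \<open>B\<close>, where \<open>n = CARD('n)\<close>
  and \<open>m = CARD('m)\<close>.
\<close>

definition laguerre_process ::
    "'w measure \<Rightarrow> (real \<Rightarrow> 'w \<Rightarrow> complex^'m^'n) \<Rightarrow> complex^'m^'m \<Rightarrow> (real \<Rightarrow> 'w \<Rightarrow> complex^'m^'m) \<Rightarrow> bool"
    where
  "laguerre_process M B x0 X \<longleftrightarrow>
     (\<exists>b. complex_brownian_matrix M b B \<and> x0 = conj_transpose b ** b) \<and>
     (\<forall>t\<ge>0. \<forall>\<omega>\<in>space M. X t \<omega> = conj_transpose (B t \<omega>) ** B t \<omega>)"

section \<open>Infinitesimal generator\<close>

text \<open>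
  For a process \<open>X\<close> started at \<open>x\<close>, the function \<open>f\<close> belongs to the domain of the generator at
  \<open>x\<close>, and the generator takes the value \<open>c\<close> there, if the expectations \<open>P\<^sub>t f(x) = E\<^sub>x f(X\<^sub>t)\<close>
  exist for small \<open>t\<close> and \<open>(P\<^sub>t f(x) - f(x)) / t\<close> tends to \<open>c\<close> as \<open>t\<close> decreases to \<open>0\<close>.
  Without the first condition the Bochner integral would silently be \<open>0\<close>.
\<close>

definition has_generator_value ::
    "'w measure \<Rightarrow> (real \<Rightarrow> 'w \<Rightarrow> 's) \<Rightarrow> 's \<Rightarrow> ('s \<Rightarrow> real) \<Rightarrow> real \<Rightarrow> bool" where
  "has_generator_value M X x f c \<longleftrightarrow>
     (\<forall>\<^sub>F t in at_right 0. integrable M (\<lambda>\<omega>. f (X t \<omega>))) \<and>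
     ((\<lambda>t. ((\<integral>\<omega>. f (X t \<omega>) \<partial>M) - f x) / t) \<longlongrightarrow> c) (at_right 0)"

section \<open>Functions of the entries and matrix-valued differential operators\<close>

text \<open>
  A function of the entries \<open>x\<^sub>j\<^sub>k\<close>, \<open>y\<^sub>j\<^sub>k\<close>, all treated as separate variables, is a function on
  pairs of arbitrary real matrices.
\<close>

type_synonym 'm entry_fun = "(real^'m^'m) \<times> (real^'m^'m) \<Rightarrow> real"

definition entries :: "complex^'m^'m \<Rightarrow> (real^'m^'m) \<times> (real^'m^'m)" where
  "entries Z = ((\<chi> j k. Re (Z $ j $ k)), (\<chi> j k. Im (Z $ j $ k)))"

definition C1_fun :: "('a::euclidean_space \<Rightarrow> real) \<Rightarrow> bool" where
  "C1_fun f \<longleftrightarrow> (\<forall>p. f differentiable (at p)) \<and>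
     (\<forall>v. continuous_on UNIV (\<lambda>p. frechet_derivative f (at p) v))"

definition C2_fun :: "('a::euclidean_space \<Rightarrow> real) \<Rightarrow> bool" where
  "C2_fun f \<longleftrightarrow> C1_fun f \<and> (\<forall>v. C1_fun (\<lambda>p. frechet_derivative f (at p) v))"

text \<open>\<open>axis j (axis k 1)\<close> is the matrix whose only nonzero entry is a \<open>1\<close> at position \<open>(j, k)\<close>.\<close>

definition partial_x :: "'m::finite \<Rightarrow> 'm \<Rightarrow> 'm entry_fun \<Rightarrow> 'm entry_fun" where
  "partial_x j k f = (\<lambda>(x, y). deriv (\<lambda>h. f (x + h *\<^sub>R axis j (axis k 1), y)) 0)"

definition partial_y :: "'m::finite \<Rightarrow> 'm \<Rightarrow> 'm entry_fun \<Rightarrow> 'm entry_fun" where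
  "partial_y j k f = (\<lambda>(x, y). deriv (\<lambda>h. f (x, y + h *\<^sub>R axis j (axis k 1))) 0)"

definition hermitian_compatible :: "('m::finite) entry_fun \<Rightarrow> bool" where
  "hermitian_compatible f \<longleftrightarrow>
     (\<forall>i j. partial_x i j f = partial_x j i f) \<and>
     (\<forall>i j p. partial_y i j f p = - partial_y j i f p)"

text \<open>Matrices whose entries are operators with real coefficients; the entries multiply by composition.\<close>

type_synonym 'm op_matrix = "(('m entry_fun \<Rightarrow> 'm entry_fun)^'m)^'m"

definition ddx :: "('m::finite) op_matrix" where
  "ddx = (\<chi> j k. partial_x j k)"

definition ddy :: "('m::finite) op_matrix" where
  "ddy = (\<chi> j k. partial_y j k)"

definition op_add :: "('m::finite) op_matrix \<Rightarrow> 'm op_matrix \<Rightarrow> 'm op_matrix" where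
  "op_add P Q = (\<chi> i j. (\<lambda>f p. (P $ i $ j) f p + (Q $ i $ j) f p))"

definition op_neg :: "('m::finite) op_matrix \<Rightarrow> 'm op_matrix" where
  "op_neg P = (\<chi> i j. (\<lambda>f p. - (P $ i $ j) f p))"

definition op_mult :: "('m::finite) op_matrix \<Rightarrow> 'm op_matrix \<Rightarrow> 'm op_matrix" where
  "op_mult P Q = (\<chi> i j. (\<lambda>f p. \<Sum>k\<in>UNIV. (P $ i $ k) ((Q $ k $ j) f) p))"

definition op_apply :: "('m::finite) op_matrix \<Rightarrow> 'm entry_fun \<Rightarrow> (real^'m^'m) \<times> (real^'m^'m) \<Rightarrow> real^'m^'m" where
  "op_apply P f p = (\<chi> i j. (P $ i $ j) f p)"

text \<open>
  Formal complex operator matrices \<open>P + iQ\<close> with \<open>P\<close>, \<open>Q\<close> real, and their product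
  \<open>(P + iQ)(R + iS) = (PR - QS) + i(PS + QR)\<close>. Real and imaginary parts are the formal ones.
\<close>

datatype 'm cop_matrix = COp (re_op: "'m op_matrix") (im_op: "'m op_matrix")

definition cop_mult :: "('m::finite) cop_matrix \<Rightarrow> 'm cop_matrix \<Rightarrow> 'm cop_matrix" where
  "cop_mult A C = COp
     (op_add (op_mult (re_op A) (re_op C)) (op_neg (op_mult (im_op A) (im_op C))))
     (op_add (op_mult (re_op A) (im_op C)) (op_mult (im_op A) (re_op C)))"

definition ddz :: "('m::finite) cop_matrix" where
  "ddz = COp ddx (op_neg ddy)"

text \<open>
  In \<open>trace (x ** op_apply P f (x, y))\<close> the operators act on \<open>f\<close> only, not on the coefficient \<open>x\<close>.
\<close>

definition laguerre_operator :: "nat \<Rightarrow> ('m::finite) entry_fun \<Rightarrow> 'm entry_fun" where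
  "laguerre_operator n f = (\<lambda>(x, y).
     2 * real n * trace (op_apply (re_op ddz) f (x, y)) +
     2 * (trace (x ** op_apply (re_op (cop_mult ddz ddz)) f (x, y)) +
          trace (y ** op_apply (im_op (cop_mult ddz ddz)) f (x, y))))"

section \<open>The real and imaginary parts of the squared operator\<close>

lemma C1_fun_line_deriv:
  assumes "C1_fun f"
  shows "((\<lambda>h. f (p + h *\<^sub>R v)) has_field_derivative frechet_derivative f (at p) v) (at 0)"
proof -
  have f: "(f has_derivative frechet_derivative f (at p)) (at p)"
    using assms by (simp add: C1_fun_def frechet_derivative_works)
  have lin: "linear (frechet_derivative f (at p))"
    using f has_derivative_linear by blast
  have "((\<lambda>h::real. p + h *\<^sub>R v) has_derivative (\<lambda>h. h *\<^sub>R v)) (at 0)"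
    by (auto intro!: derivative_eq_intros)
  moreover have "(f has_derivative frechet_derivative f (at p)) (at (p + 0 *\<^sub>R v))"
    using f by simp
  ultimately have "((\<lambda>h. f (p + h *\<^sub>R v)) has_derivative
      (\<lambda>h. frechet_derivative f (at p) (h *\<^sub>R v))) (at 0)"
    by (rule has_derivative_compose)
  then show ?thesis
    by (simp add: has_field_derivative_def linear_cmul[OF lin] mult_commute_abs)
qed

lemma partial_x_frechet:
  "C1_fun f \<Longrightarrow> partial_x j k f = (\<lambda>p. frechet_derivative f (at p) (axis j (axis k 1), 0))"
  using DERIV_imp_deriv[OF C1_fun_line_deriv[of f _ "(axis j (axis k 1), 0)"]]
  by (fastforce simp: partial_x_def)

lemma partial_y_frechet:
  "C1_fun f \<Longrightarrow> partial_y j k f = (\<lambda>p. frechet_derivative f (at p) (0, axis j (axis k 1)))"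
  using DERIV_imp_deriv[OF C1_fun_line_deriv[of f _ "(0, axis j (axis k 1))"]]
  by (fastforce simp: partial_y_def)

lemma C1_fun_partial_y: "C2_fun f \<Longrightarrow> C1_fun (partial_y j k f)"
  by (simp add: C2_fun_def partial_y_frechet)

lemma C1_fun_uminus:
  assumes "C1_fun f"
  shows "C1_fun (\<lambda>p. - f p)" "frechet_derivative (\<lambda>p. - f p) (at p) v = - frechet_derivative f (at p) v"
proof -
  have d: "((\<lambda>p. - f p) has_derivative (\<lambda>v. - frechet_derivative f (at p) v)) (at p)" for p
    using assms by (auto simp: C1_fun_def frechet_derivative_works intro!: derivative_intros)
  have e: "frechet_derivative (\<lambda>p. - f p) (at p) = (\<lambda>v. - frechet_derivative f (at p) v)" for p
    using frechet_derivative_at[OF d] by simp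
  show "frechet_derivative (\<lambda>p. - f p) (at p) v = - frechet_derivative f (at p) v"
    by (simp add: e)
  show "C1_fun (\<lambda>p. - f p)"
    using assms d by (auto simp: C1_fun_def e differentiable_def intro!: continuous_intros)
qed

lemma re_op_ddz: "re_op ddz = ddx"
  by (simp add: ddz_def)

lemma partial_uminus:
  assumes "C1_fun f"
  shows "partial_x j k (\<lambda>p. - f p) = (\<lambda>p. - partial_x j k f p)"
    and "partial_y j k (\<lambda>p. - f p) = (\<lambda>p. - partial_y j k f p)"
  using assms by (simp_all add: partial_x_frechet partial_y_frechet C1_fun_uminus)

lemma re_op_ddz_squared:
  assumes "C2_fun f"
  shows "op_apply (re_op (cop_mult ddz ddz)) f =
         op_apply (op_add (op_mult ddx ddx) (op_neg (op_mult ddy ddy))) f"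
  using assms
  by (simp add: fun_eq_iff vec_eq_iff op_apply_def cop_mult_def ddz_def op_add_def op_neg_def op_mult_def
      ddx_def ddy_def partial_uminus C1_fun_partial_y)

lemma im_op_ddz_squared:
  assumes "C2_fun f"
  shows "op_apply (im_op (cop_mult ddz ddz)) f =
         op_apply (op_neg (op_add (op_mult ddx ddy) (op_mult ddy ddx))) f"
  using assms
  by (simp add: fun_eq_iff vec_eq_iff op_apply_def cop_mult_def ddz_def op_add_def op_neg_def op_mult_def
      ddx_def ddy_def partial_uminus C1_fun_partial_y sum_negf)

end

theory Submission
  imports Defs "HOL-Real_Asymp.Real_Asymp"
begin

text \<open>
  Almost surely, \<open>X\<^sub>t\<close> is a function of the Gaussian vector \<open>u\<close> of the increments
  over \<open>[0, t]\<close> of the \<open>2nm\<close> real entries of \<open>B\<close>. If \<open>E\<^sub>e\<close> is the matrix that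
  carries \<open>1\<close> or \<open>\<i>\<close> in one place, then \<open>B\<^sub>t = b + \<Sum> u\<^sub>e E\<^sub>e\<close>, so the
  entries of \<open>X\<^sub>t\<close> form a quadratic polynomial
  \<open>p + \<Sum> u\<^sub>e L\<^sub>e + \<Sum> u\<^sub>e u\<^sub>d Q\<^sub>e\<^sub>d\<close> in \<open>u\<close>.
  The generator is the derivative at time \<open>0\<close> of the expectation of a function of this
  Gaussian vector, and a Taylor expansion of order two at \<open>p\<close> determines it. The
  terms linear in \<open>u\<close> have mean \<open>0\<close>, the products \<open>u\<^sub>e u\<^sub>d\<close> have mean \<open>t\<close> on the
  diagonal and \<open>0\<close> off it, and what is left is
  \<open>\<Sum>\<^sub>e (Df(p) Q\<^sub>e\<^sub>e + D\<^sup>2f(p)(L\<^sub>e, L\<^sub>e) / 2)\<close>.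

  The Taylor remainder is small only near \<open>p\<close>, while \<open>f\<close> may grow as fast as
  integrability of \<open>f(X\<^sub>t)\<close> permits. The tail is controlled by comparing Gaussian
  densities at two times: outside a ball, the density at time \<open>s\<close> is at most
  \<open>C(s)\<close> times the density at a fixed later time \<open>t\<close>, with \<open>C(s) / s \<longrightarrow> 0\<close>
  (\<open>normal_density_product_le\<close>, \<open>gaussian_tail_constant_tendsto_0\<close>). Hence one
  integrable time bounds the tails of all earlier ones, which gives
  \<open>gaussian_second_order_limit\<close>.

  It remains to recognise the sum over \<open>e\<close>. Since \<open>E\<^sub>e\<^sup>\<star>E\<^sub>e\<close> is a diagonal matrix unit,
  the first order terms give \<open>2n tr(\<partial>/\<partial>x)\<close>. For \<open>e\<close> in row \<open>j\<close> and column \<open>k\<close>,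
  \<open>L\<^sub>e\<close> is the Hermitian matrix supported on row and column \<open>k\<close> that is built from
  row \<open>j\<close> of \<open>b\<close>. The symmetry conditions on \<open>f\<close> let every derivative
  \<open>\<partial>/\<partial>x\<^sub>k\<^sub>i\<close>, \<open>\<partial>/\<partial>y\<^sub>k\<^sub>i\<close> be replaced by \<open>\<partial>/\<partial>x\<^sub>i\<^sub>k\<close>, \<open>- \<partial>/\<partial>y\<^sub>i\<^sub>k\<close>
  (\<open>hermitian_compatible_second_derivative\<close>); summing the resulting quadratic forms
  over \<open>j\<close> produces the coefficients \<open>x = \<Re>(b\<^sup>\<star>b)\<close> and \<open>y = \<Im>(b\<^sup>\<star>b)\<close>
  (\<open>laguerre_operator_gram_entries\<close>).
\<close>

section \<open>Gaussian vectors with small variance\<close>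

text \<open>
  The parameter \<open>t\<close> is the common variance, so that the increments over \<open>[0, t]\<close> of
  independent Brownian motions satisfy the predicate with that same \<open>t\<close>.
\<close>

definition gaussian_vector :: "'w measure \<Rightarrow> real \<Rightarrow> ('e::finite \<Rightarrow> 'w \<Rightarrow> real) \<Rightarrow> bool" where
  "gaussian_vector M t Y \<longleftrightarrow> prob_space.indep_vars M (\<lambda>_. borel) Y UNIV \<and>
     (\<forall>e. distributed M lborel (Y e) (normal_density 0 (sqrt t)))"

lemma gaussian_vector_measurable:
  assumes "gaussian_vector M t Y"
  shows "Y e \<in> borel_measurable M"
  using assms by (auto simp: gaussian_vector_def distributed_def)

lemma gaussian_vector_measurable_PiM:
  assumes "gaussian_vector M t Y"
  shows "(\<lambda>\<omega> e. Y e \<omega>) \<in> measurable M (Pi\<^sub>M UNIV (\<lambda>_. borel))"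
proof -
  have "(\<lambda>\<omega>. \<lambda>e\<in>UNIV. Y e \<omega>) \<in> measurable M (Pi\<^sub>M UNIV (\<lambda>_. borel))"
    using gaussian_vector_measurable[OF assms] by (intro measurable_restrict) simp
  then show ?thesis by (simp add: restrict_def)
qed

text \<open>
  Under Lebesgue measure as the common reference, Gaussian vectors of different variance
  can be compared through their densities.
\<close>

lemma nn_integral_gaussian_vector:
  fixes Y :: "'e::finite \<Rightarrow> 'w \<Rightarrow> real" and H :: "('e \<Rightarrow> real) \<Rightarrow> ennreal"
  assumes "prob_space M" and Y: "gaussian_vector M t Y"
    and H [measurable]: "H \<in> borel_measurable (Pi\<^sub>M UNIV (\<lambda>_. borel))"
  shows "(\<integral>\<^sup>+\<omega>. H (\<lambda>e. Y e \<omega>) \<partial>M) =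
    (\<integral>\<^sup>+u. (\<Prod>e\<in>UNIV. ennreal (normal_density 0 (sqrt t) (u e))) * H u \<partial>Pi\<^sub>M UNIV (\<lambda>_. lborel))"
proof -
  interpret prob_space M by fact
  let ?\<rho> = "\<lambda>x. ennreal (normal_density 0 (sqrt t) x)"
  let ?L = "Pi\<^sub>M UNIV (\<lambda>_::'e. lborel :: real measure)"
  let ?P = "\<lambda>u. \<Prod>e\<in>UNIV. ?\<rho> (u e)"
  have Ym [measurable]: "Y e \<in> borel_measurable M" for e
    by (rule gaussian_vector_measurable[OF Y])
  have d: "distr M borel (Y e) = density lborel ?\<rho>" for e
  proof -
    have "distr M lborel (Y e) = density lborel ?\<rho>"
      using Y by (auto simp: gaussian_vector_def distributed_def)
    then show ?thesis
      by (metis distr_cong sets_lborel)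
  qed
  have PiM_borel: "sets (Pi\<^sub>M UNIV (\<lambda>_::'e. borel :: real measure)) = sets ?L"
    by (intro sets_PiM_cong) auto
  have P [measurable]: "?P \<in> borel_measurable ?L"
    by measurable
  have HL [measurable]: "H \<in> borel_measurable ?L"
    using H measurable_cong_sets[OF PiM_borel refl] by blast
  interpret L: product_sigma_finite "\<lambda>_::'e. lborel :: real measure"
    by standard
  have dp: "prob_space (density lborel ?\<rho>)"
    by (metis Ym d prob_space_distr)
  then have ds: "sigma_finite_measure (density lborel ?\<rho>)"
    using prob_space_imp_sigma_finite by blast
  interpret D: product_sigma_finite "\<lambda>_::'e. density lborel ?\<rho>"
    using ds by (simp add: product_sigma_finite_def)
  have "distr M (Pi\<^sub>M UNIV (\<lambda>_. borel)) (\<lambda>\<omega>. \<lambda>e\<in>UNIV. Y e \<omega>) = Pi\<^sub>M UNIV (\<lambda>e. distr M borel (Y e))"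
    using Y Ym by (subst indep_vars_iff_distr_eq_PiM[symmetric]) (auto simp: gaussian_vector_def)
  also have "\<dots> = Pi\<^sub>M UNIV (\<lambda>_. density lborel ?\<rho>)"
    by (simp add: d)
  also have "\<dots> = density ?L ?P"
  proof (rule D.PiM_eqI[symmetric])
    show "sets (density ?L ?P) = sets (Pi\<^sub>M UNIV (\<lambda>_. density lborel ?\<rho>))"
      unfolding sets_density by (intro sets_PiM_cong) auto
    fix A assume "\<And>i::'e. i \<in> UNIV \<Longrightarrow> A i \<in> sets (density lborel ?\<rho>)"
    then have A [measurable]: "A i \<in> sets lborel" for i
      by simp
    have "emeasure (density ?L ?P) (Pi\<^sub>E UNIV A) = (\<integral>\<^sup>+u. ?P u * indicator (Pi\<^sub>E UNIV A) u \<partial>?L)"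
      by (intro emeasure_density) (auto intro: sets_PiM_I_finite)
    also have "\<dots> = (\<integral>\<^sup>+u. (\<Prod>e\<in>UNIV. ?\<rho> (u e) * indicator (A e) (u e)) \<partial>?L)"
      by (intro nn_integral_cong)
         (auto simp: prod.distrib indicator_def PiE_def Pi_def prod_zero_iff split: if_splits)
    also have "\<dots> = (\<Prod>e\<in>UNIV. \<integral>\<^sup>+x. ?\<rho> x * indicator (A e) x \<partial>lborel)"
      using A by (intro L.product_nn_integral_prod) auto
    also have "\<dots> = (\<Prod>e\<in>UNIV. emeasure (density lborel ?\<rho>) (A e))"
      using A by (intro prod.cong refl emeasure_density[symmetric]) auto
    finally show "emeasure (density ?L ?P) (Pi\<^sub>E UNIV A) =
        (\<Prod>i\<in>UNIV. emeasure (density lborel ?\<rho>) (A i))" .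
  qed simp
  finally have law: "distr M (Pi\<^sub>M UNIV (\<lambda>_. borel)) (\<lambda>\<omega> e. Y e \<omega>) = density ?L ?P"
    by (simp add: restrict_def)
  have "(\<integral>\<^sup>+\<omega>. H (\<lambda>e. Y e \<omega>) \<partial>M) = (\<integral>\<^sup>+u. H u \<partial>distr M (Pi\<^sub>M UNIV (\<lambda>_. borel)) (\<lambda>\<omega> e. Y e \<omega>))"
    using gaussian_vector_measurable_PiM[OF Y] by (simp add: nn_integral_distr)
  also have "\<dots> = (\<integral>\<^sup>+u. ?P u * H u \<partial>?L)"
    unfolding law by (intro nn_integral_density) auto
  finally show ?thesis .
qed

text \<open>
  The quotient of the one-dimensional densities with variances \<open>s \<le> t\<close> is
  \<open>sqrt (t / s) exp (- x\<^sup>2 / 2 (1 / s - 1 / t))\<close>. In the product over the coordinates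
  the exponents add up to a multiple of \<open>\<Sum> u\<^sub>e\<^sup>2\<close>, which is at least \<open>r\<close>.
  Bounding \<open>sqrt (t / s)\<close> by \<open>t / s\<close> avoids fractional powers.
\<close>

lemma normal_density_product_le:
  fixes u :: "'e::finite \<Rightarrow> real"
  assumes st: "0 < s" "s \<le> t" and r: "r \<le> (\<Sum>e\<in>UNIV. (u e)\<^sup>2)"
  shows "(\<Prod>e\<in>UNIV. normal_density 0 (sqrt s) (u e)) \<le>
    (t / s) ^ CARD('e) * exp (- (r / 2 * (1 / s - 1 / t))) * (\<Prod>e\<in>UNIV. normal_density 0 (sqrt t) (u e))"
proof -
  have 1: "normal_density 0 (sqrt s) x \<le>
      t / s * exp (- (x\<^sup>2 / 2 * (1 / s - 1 / t))) * normal_density 0 (sqrt t) x" for x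
  proof -
    have "1 / sqrt (2 * pi * s) = sqrt (t / s) * (1 / sqrt (2 * pi * t))"
      using st by (simp add: real_sqrt_mult real_sqrt_divide)
    also have "\<dots> \<le> t / s * (1 / sqrt (2 * pi * t))"
    proof (rule mult_right_mono)
      show "sqrt (t / s) \<le> t / s"
        using st sqrt_le_D self_le_power[of "t / s" 2] by (intro real_le_lsqrt) auto
    qed (use st in simp)
    finally have a: "1 / sqrt (2 * pi * s) \<le> t / s * (1 / sqrt (2 * pi * t))" .
    have b: "exp (- x\<^sup>2 / (2 * s)) = exp (- (x\<^sup>2 / 2 * (1 / s - 1 / t))) * exp (- x\<^sup>2 / (2 * t))"
      using st by (simp add: exp_add[symmetric] field_simps)
    have d: "normal_density 0 (sqrt s) x = 1 / sqrt (2 * pi * s) * exp (- x\<^sup>2 / (2 * s))"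
      if "0 < s" for s
      using that by (simp add: normal_density_def)
    have "normal_density 0 (sqrt s) x \<le> t / s * (1 / sqrt (2 * pi * t)) * exp (- x\<^sup>2 / (2 * s))"
      unfolding d[OF st(1)] by (rule mult_right_mono[OF a]) simp
    also have "\<dots> = t / s * exp (- (x\<^sup>2 / 2 * (1 / s - 1 / t))) * normal_density 0 (sqrt t) x"
      unfolding b d[OF less_le_trans[OF st]] by (simp only: mult_ac)
    finally show ?thesis .
  qed
  have "(\<Prod>e\<in>UNIV. normal_density 0 (sqrt s) (u e)) \<le>
      (\<Prod>e\<in>UNIV. t / s * exp (- ((u e)\<^sup>2 / 2 * (1 / s - 1 / t))) * normal_density 0 (sqrt t) (u e))"
    by (intro prod_mono conjI 1) simp
  also have "\<dots> = (t / s) ^ CARD('e) * exp (- ((\<Sum>e\<in>UNIV. (u e)\<^sup>2) / 2 * (1 / s - 1 / t))) *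
      (\<Prod>e\<in>UNIV. normal_density 0 (sqrt t) (u e))"
    by (simp only: prod.distrib prod_constant exp_sum[OF finite, symmetric] sum_negf sum_distrib_right
        sum_divide_distrib)
  also have "\<dots> \<le> (t / s) ^ CARD('e) * exp (- (r / 2 * (1 / s - 1 / t))) *
      (\<Prod>e\<in>UNIV. normal_density 0 (sqrt t) (u e))"
    using st r by (intro mult_right_mono mult_left_mono)
      (auto intro!: prod_nonneg mult_right_mono divide_right_mono simp: frac_le)
  finally show ?thesis .
qed

text \<open>
  Vanishing of \<open>H\<close> on a ball around the origin is the form in which the restriction to
  the tail is expressed.
\<close>

lemma gaussian_tail_comparison:
  fixes Y Z :: "'e::finite \<Rightarrow> 'w \<Rightarrow> real" and H :: "('e \<Rightarrow> real) \<Rightarrow> real"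
  assumes "prob_space M" and Y: "gaussian_vector M s Y" and Z: "gaussian_vector M t Z"
    and st: "0 < s" "s \<le> t"
    and H [measurable]: "H \<in> borel_measurable (Pi\<^sub>M UNIV (\<lambda>_. borel))"
    and nonneg: "\<And>u. 0 \<le> H u"
    and zero: "\<And>u. (\<Sum>e\<in>UNIV. (u e)\<^sup>2) < r \<Longrightarrow> H u = 0"
    and int: "integrable M (\<lambda>\<omega>. H (\<lambda>e. Z e \<omega>))"
  shows "integrable M (\<lambda>\<omega>. H (\<lambda>e. Y e \<omega>))"
    and "(\<integral>\<omega>. H (\<lambda>e. Y e \<omega>) \<partial>M) \<le>
      (t / s) ^ CARD('e) * exp (- (r / 2 * (1 / s - 1 / t))) * (\<integral>\<omega>. H (\<lambda>e. Z e \<omega>) \<partial>M)"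
proof -
  define C where "C = (t / s) ^ CARD('e) * exp (- (r / 2 * (1 / s - 1 / t)))"
  let ?P = "\<lambda>s u. \<Prod>e\<in>UNIV. ennreal (normal_density 0 (sqrt s) (u e))"
  let ?L = "Pi\<^sub>M UNIV (\<lambda>_::'e. lborel :: real measure)"
  have C: "0 \<le> C"
    using st by (simp add: C_def)
  have PiM_borel: "sets (Pi\<^sub>M UNIV (\<lambda>_::'e. borel :: real measure)) = sets ?L"
    by (intro sets_PiM_cong) auto
  have HL [measurable]: "H \<in> borel_measurable ?L"
    using H measurable_cong_sets[OF PiM_borel refl] by blast
  have HY: "(\<lambda>\<omega>. H (\<lambda>e. Y e \<omega>)) \<in> borel_measurable M"
    using measurable_compose[OF gaussian_vector_measurable_PiM[OF Y] H] .
  have "(\<integral>\<^sup>+\<omega>. ennreal (H (\<lambda>e. Y e \<omega>)) \<partial>M) = (\<integral>\<^sup>+u. ?P s u * ennreal (H u) \<partial>?L)"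
    by (rule nn_integral_gaussian_vector[OF assms(1) Y]) measurable
  also have "\<dots> \<le> (\<integral>\<^sup>+u. ennreal C * (?P t u * ennreal (H u)) \<partial>?L)"
  proof (rule nn_integral_mono)
    fix u :: "'e \<Rightarrow> real"
    show "?P s u * ennreal (H u) \<le> ennreal C * (?P t u * ennreal (H u))"
    proof (cases "(\<Sum>e\<in>UNIV. (u e)\<^sup>2) < r")
      case False
      then have "(\<Prod>e\<in>UNIV. normal_density 0 (sqrt s) (u e)) \<le> C * (\<Prod>e\<in>UNIV. normal_density 0 (sqrt t) (u e))"
        unfolding C_def by (intro normal_density_product_le st) simp
      then have "?P s u \<le> ennreal C * ?P t u"
        using C by (simp add: prod_ennreal ennreal_mult[symmetric] prod_nonneg ennreal_leI)
      then show ?thesis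
        by (metis mult.assoc mult_right_mono zero_le)
    qed (simp add: zero)
  qed
  also have "\<dots> = ennreal C * (\<integral>\<^sup>+u. ?P t u * ennreal (H u) \<partial>?L)"
    by (rule nn_integral_cmult) measurable
  also have "(\<integral>\<^sup>+u. ?P t u * ennreal (H u) \<partial>?L) = (\<integral>\<^sup>+\<omega>. ennreal (H (\<lambda>e. Z e \<omega>)) \<partial>M)"
    by (rule nn_integral_gaussian_vector[OF assms(1) Z, symmetric]) measurable
  also have "\<dots> = ennreal (\<integral>\<omega>. H (\<lambda>e. Z e \<omega>) \<partial>M)"
    by (rule nn_integral_eq_integral[OF int]) (simp add: nonneg)
  finally have le: "(\<integral>\<^sup>+\<omega>. ennreal (H (\<lambda>e. Y e \<omega>)) \<partial>M) \<le> ennreal (C * (\<integral>\<omega>. H (\<lambda>e. Z e \<omega>) \<partial>M))"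
    using C by (simp add: ennreal_mult nonneg)
  show iY: "integrable M (\<lambda>\<omega>. H (\<lambda>e. Y e \<omega>))"
    using le HY by (intro integrableI_bounded) (auto simp: nonneg intro: le_less_trans)
  show "(\<integral>\<omega>. H (\<lambda>e. Y e \<omega>) \<partial>M) \<le>
      (t / s) ^ CARD('e) * exp (- (r / 2 * (1 / s - 1 / t))) * (\<integral>\<omega>. H (\<lambda>e. Z e \<omega>) \<partial>M)"
    unfolding C_def[symmetric]
    using le C by (subst (asm) nn_integral_eq_integral[OF iY])
       (auto simp: nonneg ennreal_le_iff Bochner_Integration.integral_nonneg)
qed

lemma gaussian_tail_constant_tendsto_0:
  assumes "0 < r" "0 < t"
  shows "((\<lambda>s. (t / s) ^ d * exp (- (r / 2 * (1 / s - 1 / t))) / s) \<longlongrightarrow> (0::real)) (at_right 0)"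
  using assms by real_asymp

lemma gaussian_vector_moments:
  fixes Y :: "'e::finite \<Rightarrow> 'w \<Rightarrow> real"
  assumes "prob_space M" and Y: "gaussian_vector M t Y" and t: "0 < t"
  shows "integrable M (Y i)" "(\<integral>\<omega>. Y i \<omega> \<partial>M) = 0"
    and "integrable M (\<lambda>\<omega>. Y i \<omega> * Y j \<omega>)"
    and "(\<integral>\<omega>. Y i \<omega> * Y j \<omega> \<partial>M) = (if i = j then t else 0)"
proof -
  interpret prob_space M by fact
  have D: "distributed M lborel (Y i) (normal_density 0 (sqrt t))" for i
    using Y by (simp add: gaussian_vector_def)
  show m: "integrable M (Y i)" for i
    using distributed_integrable[OF D, of "\<lambda>x. x"] integrable_normal_moment_nz_1[of "sqrt t" 0] t by simp
  show e: "(\<integral>\<omega>. Y i \<omega> \<partial>M) = 0" for i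
    using normal_distributed_expectation[OF _ D] t by simp
  have "integrable M (\<lambda>\<omega>. (Y i \<omega>)\<^sup>2)"
    using distributed_integrable[OF D, of "\<lambda>x. x\<^sup>2"] integrable_normal_moment[of "sqrt t" 0 2] t by simp
  moreover have "(\<integral>\<omega>. (Y i \<omega>)\<^sup>2 \<partial>M) = t"
    using normal_distributed_variance[OF _ D, of i] t e by simp
  moreover have "integrable M (\<lambda>\<omega>. Y i \<omega> * Y j \<omega>) \<and> (\<integral>\<omega>. Y i \<omega> * Y j \<omega> \<partial>M) = 0" if "i \<noteq> j"
  proof -
    have "indep_vars (\<lambda>_. borel) Y {i, j}"
      using Y indep_vars_subset[of "\<lambda>_. borel" Y UNIV] by (simp add: gaussian_vector_def)
    from indep_vars_lebesgue_integral[OF _ this] indep_vars_integrable[OF _ this] m e that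
    show ?thesis by simp
  qed
  ultimately show "integrable M (\<lambda>\<omega>. Y i \<omega> * Y j \<omega>)"
    and "(\<integral>\<omega>. Y i \<omega> * Y j \<omega> \<partial>M) = (if i = j then t else 0)"
    by (auto simp: power2_eq_square)
qed

text \<open>
  The remainder \<open>R\<close> of the expansion contributes at most \<open>\<epsilon>\<close> times the mean of
  \<open>\<Sum> u\<^sub>e\<^sup>2\<close>, which is \<open>O(t)\<close>, near the origin; far from it, the tail comparison with
  a fixed time \<open>t0\<close> at which \<open>h\<close> is integrable bounds its contribution by \<open>o(t)\<close>.
\<close>

theorem gaussian_second_order_limit:
  fixes Y :: "real \<Rightarrow> 'e::finite \<Rightarrow> 'w \<Rightarrow> real" and h :: "('e \<Rightarrow> real) \<Rightarrow> real"
  assumes M: "prob_space M" and Y: "\<And>t. 0 < t \<Longrightarrow> gaussian_vector M t (Y t)"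
    and h [measurable]: "h \<in> borel_measurable (Pi\<^sub>M UNIV (\<lambda>_. borel))"
    and int: "\<forall>\<^sub>F t in at_right 0. integrable M (\<lambda>\<omega>. h (\<lambda>e. Y t e \<omega>))"
    and expansion: "\<And>\<epsilon>. 0 < \<epsilon> \<Longrightarrow> \<exists>r>0. \<forall>u. (\<Sum>e\<in>UNIV. (u e)\<^sup>2) < r \<longrightarrow>
      \<bar>h u - c - (\<Sum>i\<in>UNIV. u i * a i) - (\<Sum>i\<in>UNIV. \<Sum>j\<in>UNIV. u i * u j * q i j)\<bar> \<le> \<epsilon> * (\<Sum>e\<in>UNIV. (u e)\<^sup>2)"
  shows "((\<lambda>t. ((\<integral>\<omega>. h (\<lambda>e. Y t e \<omega>) \<partial>M) - c) / t) \<longlongrightarrow> (\<Sum>i\<in>UNIV. q i i)) (at_right 0)"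
proof -
  interpret prob_space M by fact
  define A where "A u = (\<Sum>i\<in>UNIV. u i * a i)" for u
  define Q where "Q u = (\<Sum>i\<in>UNIV. \<Sum>j\<in>UNIV. u i * u j * q i j)" for u
  define N where "N u = (\<Sum>e\<in>UNIV. (u e)\<^sup>2)" for u :: "'e \<Rightarrow> real"
  define R where "R u = h u - c - A u - Q u" for u
  have [measurable]: "A \<in> borel_measurable (Pi\<^sub>M UNIV (\<lambda>_. borel))"
    "Q \<in> borel_measurable (Pi\<^sub>M UNIV (\<lambda>_. borel))" "N \<in> borel_measurable (Pi\<^sub>M UNIV (\<lambda>_. borel))"
    unfolding A_def[abs_def] Q_def[abs_def] N_def[abs_def] by measurable
  have [measurable]: "R \<in> borel_measurable (Pi\<^sub>M UNIV (\<lambda>_. borel))"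
    unfolding R_def[abs_def] by measurable
  define E where "E t g = (\<integral>\<omega>. g (\<lambda>e. Y t e \<omega>) \<partial>M)" for t and g :: "('e \<Rightarrow> real) \<Rightarrow> real"
  define I where "I t g \<longleftrightarrow> integrable M (\<lambda>\<omega>. g (\<lambda>e. Y t e \<omega>))" for t and g :: "('e \<Rightarrow> real) \<Rightarrow> real"
  note mom = gaussian_vector_moments[OF M Y]
  have A: "I t A" "E t A = 0" if "0 < t" for t
    unfolding I_def A_def E_def using that by (auto simp: mom)
  have Q: "I t Q" "E t Q = t * (\<Sum>i\<in>UNIV. q i i)" if "0 < t" for t
    unfolding I_def Q_def E_def using that
    by (auto simp: mom sum_distrib_left if_distrib[of "\<lambda>x. x * _"] cong: if_cong)
  have N: "I t N" "E t N = t * CARD('e)" if "0 < t" for t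
    unfolding I_def N_def E_def power2_eq_square using that by (auto simp: mom)
  have R: "I t R" "(E t h - c) / t - (\<Sum>i\<in>UNIV. q i i) = E t R / t" if "0 < t" "I t h" for t
  proof -
    show "I t R"
      using that A(1)[of t] Q(1)[of t] by (auto simp: I_def R_def)
    have "E t R = E t h - c - E t A - E t Q"
      using that A(1)[of t] Q(1)[of t] by (simp add: E_def I_def R_def prob_space)
    then show "(E t h - c) / t - (\<Sum>i\<in>UNIV. q i i) = E t R / t"
      using that A(2) Q(2) by (simp add: field_simps)
  qed
  from int obtain t0 where t0: "0 < t0" "\<And>t. 0 < t \<Longrightarrow> t \<le> t0 \<Longrightarrow> I t h"
    unfolding eventually_at_right_field I_def by (metis dense order_le_less_trans)
  have "((\<lambda>t. E t R / t) \<longlongrightarrow> 0) (at_right 0)"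
  proof (rule tendstoI)
    fix \<epsilon> :: real assume "0 < \<epsilon>"
    \<comment> \<open>The mean of \<open>N\<close> is \<open>t CARD('e)\<close>, so the inner part contributes at most \<open>t \<epsilon> / 2\<close>.\<close>
    define \<delta> where "\<delta> = \<epsilon> / 2 / CARD('e)"
    have \<delta>: "0 < \<delta>" "\<delta> * CARD('e) = \<epsilon> / 2"
      using \<open>0 < \<epsilon>\<close> by (simp_all add: \<delta>_def)
    obtain r where r: "0 < r" "\<And>u. N u < r \<Longrightarrow> \<bar>R u\<bar> \<le> \<delta> * N u"
      using expansion[OF \<delta>(1)] unfolding R_def A_def Q_def N_def by blast
    define H where "H u = (if N u < r then 0 else \<bar>R u\<bar>)" for u
    define C where "C s = (t0 / s) ^ CARD('e) * exp (- (r / 2 * (1 / s - 1 / t0)))" for s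
    have Hm [measurable]: "H \<in> borel_measurable (Pi\<^sub>M UNIV (\<lambda>_. borel))"
      unfolding H_def[abs_def] by measurable
    have IH: "I t0 H"
    proof -
      have "I t0 R" using R t0 by simp
      then show ?thesis
        unfolding I_def
        by (rule Bochner_Integration.integrable_bound)
           (use measurable_compose[OF gaussian_vector_measurable_PiM[OF Y[OF t0(1)]] Hm] in \<open>auto simp: H_def\<close>)
    qed
    have bound: "\<bar>E t R / t\<bar> \<le> \<epsilon> / 2 + C t / t * E t0 H" if t: "0 < t" "t \<le> t0" for t
    proof -
      have IHt: "I t H" and EHt: "E t H \<le> C t * E t0 H"
        using gaussian_tail_comparison[OF M Y[OF t(1)] Y[OF t0(1)] t Hm, of r] IH
        by (auto simp: I_def E_def C_def H_def N_def)
      have "\<bar>E t R\<bar> \<le> E t (\<lambda>u. \<bar>R u\<bar>)"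
        unfolding E_def by (rule integral_abs_bound)
      also have "\<dots> \<le> E t (\<lambda>u. \<delta> * N u + H u)"
        unfolding E_def using R(1)[OF t(1) t0(2)[OF t]] N(1)[OF t(1)] IHt r(2) \<delta>(1)
        by (intro integral_mono) (auto simp: I_def H_def N_def sum_nonneg)
      also have "\<dots> = \<delta> * E t N + E t H"
        using N(1)[OF t(1)] IHt by (simp add: E_def I_def)
      also have "\<dots> \<le> t * (\<epsilon> / 2) + C t * E t0 H"
        using EHt \<delta>(2) by (simp add: N(2)[OF t(1)] algebra_simps flip: \<delta>(2))
      finally show ?thesis
        using t by (simp add: field_simps)
    qed
    have "((\<lambda>t. C t / t * E t0 H) \<longlongrightarrow> 0 * E t0 H) (at_right 0)"
      unfolding C_def by (intro tendsto_mult gaussian_tail_constant_tendsto_0 r t0 tendsto_const)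
    then have "\<forall>\<^sub>F t in at_right 0. C t / t * E t0 H < \<epsilon> / 2"
      using \<open>0 < \<epsilon>\<close> by (intro order_tendstoD) auto
    moreover have "\<forall>\<^sub>F t in at_right 0. 0 < t \<and> t \<le> t0"
      using t0(1) unfolding eventually_at_right_field by force
    ultimately show "\<forall>\<^sub>F t in at_right 0. dist (E t R / t) 0 < \<epsilon>"
    proof eventually_elim
      case (elim t)
      then have "\<bar>E t R / t\<bar> < \<epsilon>"
        using bound[of t] by linarith
      then show ?case
        by (simp only: dist_real_def diff_0_right)
    qed
  qed
  moreover have "\<forall>\<^sub>F t in at_right 0. E t R / t = (E t h - c) / t - (\<Sum>i\<in>UNIV. q i i)"
    unfolding eventually_at_right_field using R(2) t0 by (intro exI[of _ t0]) auto
  ultimately have "((\<lambda>t. (E t h - c) / t - (\<Sum>i\<in>UNIV. q i i)) \<longlongrightarrow> 0) (at_right 0)"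
    using tendsto_cong by fast
  then show ?thesis
    unfolding E_def by (simp add: LIM_zero_iff)
qed

section \<open>Second order Taylor expansion\<close>

lemma C1_fun_has_derivative:
  "C1_fun f \<Longrightarrow> (f has_derivative frechet_derivative f (at p)) (at p)"
  by (simp add: C1_fun_def frechet_derivative_works)

lemma C1_fun_linear: "C1_fun f \<Longrightarrow> linear (frechet_derivative f (at p))"
  using C1_fun_has_derivative has_derivative_linear by blast

lemma C2_fun_imp_C1_fun:
  assumes "C2_fun f"
  shows "C1_fun f" and "C1_fun (\<lambda>p. frechet_derivative f (at p) v)"
  using assms by (auto simp: C2_fun_def)

lemma C1_fun_line_deriv_at:
  assumes "C1_fun g"
  shows "((\<lambda>h. g (p + h *\<^sub>R v)) has_field_derivative frechet_derivative g (at (p + s *\<^sub>R v)) v) (at s)"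
proof -
  have "((\<lambda>h. g (p + s *\<^sub>R v + h *\<^sub>R v)) has_field_derivative
      frechet_derivative g (at (p + s *\<^sub>R v)) v) (at 0)"
    by (rule C1_fun_line_deriv[OF assms])
  then have "((\<lambda>h. g (p + (h + s) *\<^sub>R v)) has_field_derivative
      frechet_derivative g (at (p + s *\<^sub>R v)) v) (at 0)"
    by (simp add: algebra_simps)
  then show ?thesis
    using DERIV_shift[of "\<lambda>h. g (p + h *\<^sub>R v)" _ 0 s] by simp
qed

definition second_derivative ::
    "('a::euclidean_space \<Rightarrow> real) \<Rightarrow> 'a \<Rightarrow> 'a \<Rightarrow> 'a \<Rightarrow> real" where
  "second_derivative f p v w = frechet_derivative (\<lambda>q. frechet_derivative f (at q) v) (at p) w"

lemma bilinear_second_derivative: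
  assumes "C2_fun f"
  shows "bilinear (second_derivative f p)"
proof -
  let ?D = "\<lambda>v q. frechet_derivative f (at q) v"
  note f = C2_fun_imp_C1_fun(1)[OF assms] and D = C2_fun_imp_C1_fun(2)[OF assms]
  have d: "(?D v has_derivative second_derivative f p v) (at p)" for v
    using C1_fun_has_derivative[OF D] by (simp add: second_derivative_def[abs_def])
  note lin = C1_fun_linear[OF f]
  have unique: "second_derivative f p v = F" if "(?D v has_derivative F) (at p)" for v F
    using d that has_derivative_unique by blast
  have add: "second_derivative f p (v + v') = (\<lambda>w. second_derivative f p v w + second_derivative f p v' w)" for v v'
    by (rule unique, subst linear_add[OF lin]) (intro has_derivative_add d)
  have scale: "second_derivative f p (c *\<^sub>R v) = (\<lambda>w. c *\<^sub>R second_derivative f p v w)" for c v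
    by (rule unique, subst linear_cmul[OF lin]) (intro has_derivative_scaleR_right d)
  show ?thesis
    unfolding bilinear_def
  proof (intro conjI allI)
    show "linear (\<lambda>w. second_derivative f p v w)" for v
      using d has_derivative_linear by blast
    show "linear (\<lambda>v. second_derivative f p v w)" for w
      by (rule linearI) (simp_all add: add scale)
  qed
qed

text \<open>
  The definition of a \<open>C\<^sup>2\<close> function only provides continuity of each directional second
  derivative separately. Expanding \<open>v\<close> in the finite basis reduces the uniform statement to
  the finitely many pairs of basis directions.
\<close>

lemma second_derivative_uniformly_close:
  fixes f :: "'a::euclidean_space \<Rightarrow> real"
  assumes f: "C2_fun f" and "0 < \<epsilon>"
  shows "\<exists>\<delta>>0. \<forall>q. dist q p < \<delta> \<longrightarrow>
    (\<forall>v. \<bar>second_derivative f q v v - second_derivative f p v v\<bar> \<le> \<epsilon> * (norm v)\<^sup>2)"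
proof -
  let ?S = "second_derivative f"
  let ?B = "Basis :: 'a set"
  define \<eta> where "\<eta> = \<epsilon> / (real DIM('a))\<^sup>2"
  have \<eta>: "0 < \<eta>" "\<eta> * (real DIM('a))\<^sup>2 = \<epsilon>"
    using \<open>0 < \<epsilon>\<close> by (simp_all add: \<eta>_def)
  have "((\<lambda>q. ?S q i j) \<longlongrightarrow> ?S p i j) (nhds p)" for i j
  proof -
    have "continuous_on UNIV (\<lambda>q. ?S q i j)"
      using f by (simp add: C2_fun_def C1_fun_def second_derivative_def)
    then show ?thesis
      by (simp add: continuous_on_eq_continuous_at isCont_def tendsto_nhds_iff)
  qed
  then have "\<forall>\<^sub>F q in nhds p. dist (?S q i j) (?S p i j) < \<eta>" for i j
    using \<eta>(1) by (rule tendstoD)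
  then have "\<forall>\<^sub>F q in nhds p. \<forall>i\<in>?B. \<forall>j\<in>?B. dist (?S q i j) (?S p i j) < \<eta>"
    by (intro eventually_ball_finite finite_Basis ballI)
  then obtain \<delta> where \<delta>: "0 < \<delta>"
    "\<And>q i j. dist q p < \<delta> \<Longrightarrow> i \<in> ?B \<Longrightarrow> j \<in> ?B \<Longrightarrow> dist (?S q i j) (?S p i j) < \<eta>"
    unfolding eventually_nhds_metric by blast
  have "\<bar>?S q v v - ?S p v v\<bar> \<le> \<epsilon> * (norm v)\<^sup>2" if q: "dist q p < \<delta>" for q v
  proof -
    have S: "?S q v v = (\<Sum>i\<in>?B. \<Sum>j\<in>?B. (v \<bullet> i) * (v \<bullet> j) * ?S q i j)" for q
    proof -
      have "bilinear (?S q)"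
        by (rule bilinear_second_derivative[OF f])
      then have "?S q (\<Sum>i\<in>?B. (v \<bullet> i) *\<^sub>R i) (\<Sum>i\<in>?B. (v \<bullet> i) *\<^sub>R i) =
          (\<Sum>(i, j)\<in>?B \<times> ?B. ?S q ((v \<bullet> i) *\<^sub>R i) ((v \<bullet> j) *\<^sub>R j))"
        by (simp add: bilinear_sum)
      also have "\<dots> = (\<Sum>i\<in>?B. \<Sum>j\<in>?B. (v \<bullet> i) * (v \<bullet> j) * ?S q i j)"
        using \<open>bilinear (?S q)\<close>
        by (simp add: sum.cartesian_product bilinear_lmul bilinear_rmul mult.assoc)
      finally show ?thesis
        by (simp add: euclidean_representation)
    qed
    have "\<bar>?S q v v - ?S p v v\<bar> = \<bar>\<Sum>i\<in>?B. \<Sum>j\<in>?B. (v \<bullet> i) * (v \<bullet> j) * (?S q i j - ?S p i j)\<bar>"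
      by (simp add: S sum_subtractf right_diff_distrib)
    also have "\<dots> \<le> (\<Sum>i\<in>?B. \<Sum>j\<in>?B. \<bar>(v \<bullet> i) * (v \<bullet> j) * (?S q i j - ?S p i j)\<bar>)"
      by (intro order_trans[OF sum_abs] sum_mono sum_abs)
    also have "\<dots> \<le> (\<Sum>i\<in>?B. \<Sum>j\<in>?B. norm v * norm v * \<eta>)"
      unfolding abs_mult
      using \<delta>(2)[OF q] by (intro sum_mono mult_mono Basis_le_norm) (auto simp: dist_real_def intro: less_imp_le)
    also have "\<dots> = \<epsilon> * (norm v)\<^sup>2"
      by (simp add: power2_eq_square flip: \<eta>(2))
    finally show ?thesis .
  qed
  then show ?thesis
    using \<delta>(1) by blast
qed

text \<open>
  The Lagrange form of the remainder on the segment from \<open>p\<close> to \<open>p + v\<close> has the second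
  derivative at an intermediate point, which the preceding lemma exchanges for the one at \<open>p\<close>.
\<close>

lemma C2_fun_taylor:
  fixes f :: "'a::euclidean_space \<Rightarrow> real"
  assumes f: "C2_fun f" and "0 < \<epsilon>"
  shows "\<exists>\<delta>>0. \<forall>v. norm v < \<delta> \<longrightarrow>
    \<bar>f (p + v) - f p - frechet_derivative f (at p) v - second_derivative f p v v / 2\<bar> \<le> \<epsilon> * (norm v)\<^sup>2"
proof -
  obtain \<delta> where \<delta>: "0 < \<delta>"
    "\<And>q v. dist q p < \<delta> \<Longrightarrow> \<bar>second_derivative f q v v - second_derivative f p v v\<bar> \<le> \<epsilon> * (norm v)\<^sup>2"
    using second_derivative_uniformly_close[OF assms] by blast
  have "\<bar>f (p + v) - f p - frechet_derivative f (at p) v - second_derivative f p v v / 2\<bar> \<le> \<epsilon> * (norm v)\<^sup>2"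
    if v: "norm v < \<delta>" for v
  proof -
    define diff where "diff m = (if m = 0 then (\<lambda>h. f (p + h *\<^sub>R v))
      else if m = 1 then (\<lambda>h. frechet_derivative f (at (p + h *\<^sub>R v)) v)
      else (\<lambda>h. second_derivative f (p + h *\<^sub>R v) v v))" for m :: nat
    have "DERIV (diff m) t :> diff (Suc m) t" if "m < 2" for m t
    proof -
      have "((\<lambda>h. f (p + h *\<^sub>R v)) has_field_derivative frechet_derivative f (at (p + t *\<^sub>R v)) v) (at t)"
        "((\<lambda>h. frechet_derivative f (at (p + h *\<^sub>R v)) v) has_field_derivative
          frechet_derivative (\<lambda>q. frechet_derivative f (at q) v) (at (p + t *\<^sub>R v)) v) (at t)"
        by (fact C1_fun_line_deriv_at[OF C2_fun_imp_C1_fun(1)[OF f]] C1_fun_line_deriv_at[OF C2_fun_imp_C1_fun(2)[OF f]])+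
      then show ?thesis
        using that unfolding diff_def second_derivative_def by (auto simp: less_2_cases_iff)
    qed
    then obtain t where t: "0 < t" "t \<le> 1"
      "diff 0 1 = (\<Sum>m<2. diff m 0 / fact m * 1 ^ m) + diff 2 t / fact 2 * 1 ^ 2"
      using Maclaurin2[of 1 diff "diff 0" 2] by auto
    then have eq: "f (p + v) - f p - frechet_derivative f (at p) v = second_derivative f (p + t *\<^sub>R v) v v / 2"
      by (simp add: diff_def numeral_2_eq_2)
    have "dist (p + t *\<^sub>R v) p < \<delta>"
      using t v mult_right_mono[of t 1 "norm v"] by (simp add: dist_norm)
    from \<delta>(2)[OF this, of v] show ?thesis
      unfolding eq using \<open>0 < \<epsilon>\<close> zero_le_power2[of "norm v"] by auto
  qed
  then show ?thesis
    using \<delta>(1) by blast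
qed

lemma sum_scaleR_norm_le:
  fixes u :: "'e::finite \<Rightarrow> real" and L :: "'e \<Rightarrow> 'a::real_normed_vector"
  shows "norm (\<Sum>e\<in>UNIV. u e *\<^sub>R L e) \<le> sqrt (\<Sum>e\<in>UNIV. (u e)\<^sup>2) * (\<Sum>e\<in>UNIV. norm (L e))"
proof -
  have "\<bar>u e\<bar> \<le> sqrt (\<Sum>e\<in>UNIV. (u e)\<^sup>2)" for e
    using member_le_sum[of e UNIV "\<lambda>e. (u e)\<^sup>2"] by (intro real_le_rsqrt) simp
  then have "norm (\<Sum>e\<in>UNIV. u e *\<^sub>R L e) \<le> (\<Sum>e\<in>UNIV. sqrt (\<Sum>e\<in>UNIV. (u e)\<^sup>2) * norm (L e))"
    by (intro sum_norm_le) (simp add: mult_right_mono)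
  then show ?thesis
    by (simp add: sum_distrib_left)
qed

text \<open>
  With \<open>x\<close> the linear and \<open>y\<close> the quadratic part of the increment, \<open>x = O(\<bar>u\<bar>)\<close> and
  \<open>y = O(\<bar>u\<bar>\<^sup>2)\<close>; hence \<open>y\<close> counts in the first derivative only, and replacing
  \<open>D\<^sup>2f(p)(x + y, x + y)\<close> by \<open>D\<^sup>2f(p)(x, x)\<close> costs \<open>O(\<bar>u\<bar>\<^sup>3)\<close>.
\<close>

lemma C2_fun_quadratic_substitution:
  fixes f :: "'a::euclidean_space \<Rightarrow> real" and L :: "'e::finite \<Rightarrow> 'a" and Q :: "'e \<Rightarrow> 'e \<Rightarrow> 'a"
  assumes f: "C2_fun f" and "0 < \<epsilon>"
  shows "\<exists>r>0. \<forall>u. (\<Sum>e\<in>UNIV. (u e)\<^sup>2) < r \<longrightarrow>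
    \<bar>f (p + (\<Sum>i\<in>UNIV. u i *\<^sub>R L i) + (\<Sum>i\<in>UNIV. \<Sum>j\<in>UNIV. (u i * u j) *\<^sub>R Q i j)) - f p
      - (\<Sum>i\<in>UNIV. u i * frechet_derivative f (at p) (L i))
      - (\<Sum>i\<in>UNIV. \<Sum>j\<in>UNIV. u i * u j *
          (frechet_derivative f (at p) (Q i j) + second_derivative f p (L i) (L j) / 2))\<bar>
    \<le> \<epsilon> * (\<Sum>e\<in>UNIV. (u e)\<^sup>2)"
proof -
  let ?D = "frechet_derivative f (at p)" and ?S = "second_derivative f p"
  define l where "l = (\<Sum>i\<in>UNIV. norm (L i))"
  define k where "k = (\<Sum>i\<in>UNIV. \<Sum>j\<in>UNIV. norm (Q i j))"
  have lk: "0 \<le> l" "0 \<le> k"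
    by (auto simp: l_def k_def intro!: sum_nonneg)
  have bil: "bilinear ?S" and lin: "linear ?D"
    using bilinear_second_derivative[OF f] C1_fun_linear C2_fun_imp_C1_fun(1)[OF f] by auto
  obtain b where b: "0 < b" "\<And>v w. \<bar>?S v w\<bar> \<le> b * norm v * norm w"
    using bilinear_bounded_pos[OF bil] by auto
  \<comment> \<open>For \<open>\<bar>u\<bar> \<le> 1\<close> the increment has norm at most \<open>\<bar>u\<bar> (l + k)\<close>; half of \<open>\<epsilon>\<close> is spent on the
    Taylor remainder and the other half on the cross terms, whose constant is \<open>c\<close>.\<close>
  define \<eta> where "\<eta> = \<epsilon> / 2 / (l + k + 1)\<^sup>2"
  have \<eta>: "0 < \<eta>" "\<eta> * (l + k + 1)\<^sup>2 = \<epsilon> / 2"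
    using \<open>0 < \<epsilon>\<close> lk by (simp_all add: \<eta>_def)
  obtain \<delta> where \<delta>: "0 < \<delta>"
    "\<And>v. norm v < \<delta> \<Longrightarrow> \<bar>f (p + v) - f p - ?D v - ?S v v / 2\<bar> \<le> \<eta> * (norm v)\<^sup>2"
    using C2_fun_taylor[OF f \<eta>(1)] by blast
  define c where "c = b * (2 * l * k + k\<^sup>2) / 2 + 1"
  have c: "0 < c"
    using b(1) lk by (simp add: c_def add_nonneg_pos)
  define \<rho> where "\<rho> = Min {1, \<delta> / (l + k + 1), \<epsilon> / (2 * c)}"
  have \<rho>: "0 < \<rho>" "\<rho> \<le> 1" "\<rho> * (l + k + 1) \<le> \<delta>" "\<rho> * c \<le> \<epsilon> / 2"
  proof -
    show "0 < \<rho>" "\<rho> \<le> 1"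
      using \<delta>(1) lk c \<open>0 < \<epsilon>\<close> by (auto simp: \<rho>_def)
    have "\<rho> \<le> \<delta> / (l + k + 1)" "\<rho> \<le> \<epsilon> / (2 * c)"
      by (auto simp: \<rho>_def)
    then show "\<rho> * (l + k + 1) \<le> \<delta>" "\<rho> * c \<le> \<epsilon> / 2"
      using lk c by (simp_all add: field_simps)
  qed
  show ?thesis
  proof (intro exI[of _ "\<rho>\<^sup>2"] conjI allI impI)
    fix u :: "'e \<Rightarrow> real" assume u: "(\<Sum>e\<in>UNIV. (u e)\<^sup>2) < \<rho>\<^sup>2"
    define n where "n = sqrt (\<Sum>e\<in>UNIV. (u e)\<^sup>2)"
    have n2: "(\<Sum>e\<in>UNIV. (u e)\<^sup>2) = n\<^sup>2" and n0: "0 \<le> n"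
      by (simp_all add: n_def sum_nonneg)
    have n: "n < \<rho>"
      using u \<rho>(1) n0 unfolding n2 by (simp add: power_less_imp_less_base less_imp_le)
    define x where "x = (\<Sum>i\<in>UNIV. u i *\<^sub>R L i)"
    define y where "y = (\<Sum>i\<in>UNIV. \<Sum>j\<in>UNIV. (u i * u j) *\<^sub>R Q i j)"
    have x: "norm x \<le> n * l"
      unfolding x_def n_def l_def by (rule sum_scaleR_norm_le)
    have y: "norm y \<le> n * n * k"
    proof -
      have "y = (\<Sum>i\<in>UNIV. u i *\<^sub>R (\<Sum>j\<in>UNIV. u j *\<^sub>R Q i j))"
        by (simp add: y_def scaleR_right.sum)
      also have "norm \<dots> \<le> n * (\<Sum>i\<in>UNIV. norm (\<Sum>j\<in>UNIV. u j *\<^sub>R Q i j))"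
        unfolding n_def by (rule sum_scaleR_norm_le)
      also have "\<dots> \<le> n * (\<Sum>i\<in>UNIV. n * (\<Sum>j\<in>UNIV. norm (Q i j)))"
        unfolding n_def by (intro mult_left_mono sum_mono sum_scaleR_norm_le) (simp add: sum_nonneg)
      finally show ?thesis
        by (simp add: k_def sum_distrib_left mult.assoc)
    qed
    have y': "norm y \<le> n * k"
      using y n \<rho>(2) n0 lk(2) mult_right_mono[of "n * n" n k] mult_left_le[of n n] by simp
    have xy: "norm (x + y) \<le> n * (l + k + 1)"
      using norm_triangle_ineq[of x y] x y' n0 by (simp add: algebra_simps)
    also have "n * (l + k + 1) < \<rho> * (l + k + 1)"
      using n lk by simp
    finally have "\<bar>f (p + (x + y)) - f p - ?D (x + y) - ?S (x + y) (x + y) / 2\<bar> \<le> \<eta> * (norm (x + y))\<^sup>2"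
      using \<rho>(3) by (intro \<delta>(2)) simp
    also have "\<dots> \<le> \<eta> * (n * (l + k + 1))\<^sup>2"
      using xy \<eta>(1) by (intro mult_left_mono power_mono) auto
    also have "\<dots> = \<epsilon> / 2 * n\<^sup>2"
      by (simp add: power_mult_distrib flip: \<eta>(2))
    finally have main: "\<bar>f (p + (x + y)) - f p - ?D (x + y) - ?S (x + y) (x + y) / 2\<bar> \<le> \<epsilon> / 2 * n\<^sup>2" .
    have "?S (x + y) (x + y) / 2 - ?S x x / 2 = (?S x y + ?S y x + ?S y y) / 2"
      by (simp add: bilinear_ladd[OF bil] bilinear_radd[OF bil] field_simps)
    then have "\<bar>?S (x + y) (x + y) / 2 - ?S x x / 2\<bar> = \<bar>?S x y + ?S y x + ?S y y\<bar> / 2"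
      by (simp only: abs_divide abs_numeral)
    also have "\<dots> \<le> (\<bar>?S x y\<bar> + \<bar>?S y x\<bar> + \<bar>?S y y\<bar>) / 2"
      by simp
    also have "\<dots> \<le> (b * (n * l) * (n * n * k) + b * (n * n * k) * (n * l) + b * (n * n * k) * (n * k)) / 2"
      using b(1) x y y' n0 lk
      by (intro divide_right_mono add_mono order_trans[OF b(2)] mult_mono) auto
    also have "\<dots> = n * (b * (2 * l * k + k\<^sup>2) / 2) * n\<^sup>2"
      by (simp add: power2_eq_square field_simps)
    also have "\<dots> \<le> \<rho> * c * n\<^sup>2"
      using n n0 b(1) lk by (intro mult_right_mono mult_mono) (auto simp: c_def)
    also have "\<dots> \<le> \<epsilon> / 2 * n\<^sup>2"
      using \<rho>(4) by (rule mult_right_mono) simp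
    finally have cross: "\<bar>?S (x + y) (x + y) / 2 - ?S x x / 2\<bar> \<le> \<epsilon> / 2 * n\<^sup>2" .
    have Dx: "?D x = (\<Sum>i\<in>UNIV. u i * ?D (L i))"
      by (simp add: x_def linear_sum[OF lin] linear_cmul[OF lin])
    have Dy: "?D y = (\<Sum>i\<in>UNIV. \<Sum>j\<in>UNIV. u i * u j * ?D (Q i j))"
      by (simp add: y_def linear_sum[OF lin] linear_cmul[OF lin])
    have "?S x x = (\<Sum>(i, j)\<in>UNIV \<times> UNIV. ?S (u i *\<^sub>R L i) (u j *\<^sub>R L j))"
      unfolding x_def by (rule bilinear_sum[OF bil])
    then have Sx: "?S x x = (\<Sum>i\<in>UNIV. \<Sum>j\<in>UNIV. u i * u j * ?S (L i) (L j))"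
      by (simp add: sum.cartesian_product bilinear_lmul[OF bil] bilinear_rmul[OF bil] mult.assoc mult.left_commute)
    have "(\<Sum>i\<in>UNIV. \<Sum>j\<in>UNIV. u i * u j * (?D (Q i j) + ?S (L i) (L j) / 2)) = ?D y + ?S x x / 2"
      by (simp add: Dy Sx distrib_left sum.distrib sum_divide_distrib)
    moreover have "\<bar>f (p + (x + y)) - f p - ?D x - (?D y + ?S x x / 2)\<bar> \<le> \<epsilon> * n\<^sup>2"
      using main cross unfolding linear_add[OF lin] abs_le_iff by (simp add: field_simps)
    ultimately have "\<bar>f (p + (x + y)) - f p - ?D x
      - (\<Sum>i\<in>UNIV. \<Sum>j\<in>UNIV. u i * u j * (?D (Q i j) + ?S (L i) (L j) / 2))\<bar> \<le> \<epsilon> * n\<^sup>2"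
      by simp
    then show "\<bar>f (p + (\<Sum>i\<in>UNIV. u i *\<^sub>R L i) + (\<Sum>i\<in>UNIV. \<Sum>j\<in>UNIV. (u i * u j) *\<^sub>R Q i j)) - f p
      - (\<Sum>i\<in>UNIV. u i * ?D (L i)) - (\<Sum>i\<in>UNIV. \<Sum>j\<in>UNIV. u i * u j * (?D (Q i j) + ?S (L i) (L j) / 2))\<bar>
    \<le> \<epsilon> * (\<Sum>e\<in>UNIV. (u e)\<^sup>2)"
      unfolding Dx n2 by (simp only: x_def y_def add.assoc)
  qed (use \<rho>(1) in simp)
qed

text \<open>
  A function whose derivative along \<open>n\<close> vanishes identically is invariant under translation
  by multiples of \<open>n\<close>, hence so is its derivative along any \<open>v\<close>.
\<close>

lemma second_derivative_null_direction:
  assumes f: "C2_fun f" and null: "\<And>q. frechet_derivative f (at q) n = 0"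
  shows "second_derivative f p v n = 0"
proof -
  note f1 = C2_fun_imp_C1_fun(1)[OF f] and Dv = C2_fun_imp_C1_fun(2)[OF f]
  have line: "f (q + h *\<^sub>R n) = f q" for q h
  proof -
    have "DERIV (\<lambda>h. f (q + h *\<^sub>R n)) s :> 0" for s
      using C1_fun_line_deriv_at[OF f1, of q n s] by (simp add: null)
    then show ?thesis
      using DERIV_isconst_all[of "\<lambda>h. f (q + h *\<^sub>R n)" h 0] by simp
  qed
  have inv: "frechet_derivative f (at (p + h *\<^sub>R n)) = frechet_derivative f (at p)" for h
  proof -
    have "((\<lambda>q. f (q + h *\<^sub>R n)) has_derivative frechet_derivative f (at (p + h *\<^sub>R n))) (at p)"
      by (rule has_derivative_compose[where g = f, OF _ C1_fun_has_derivative[OF f1]])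
         (auto intro!: derivative_eq_intros)
    then show ?thesis
      using C1_fun_has_derivative[OF f1, of p] has_derivative_unique by (auto simp: line)
  qed
  have "((\<lambda>h. frechet_derivative f (at (p + h *\<^sub>R n)) v) has_field_derivative second_derivative f p v n) (at 0)"
    unfolding second_derivative_def by (rule C1_fun_line_deriv[OF Dv])
  then show ?thesis
    unfolding inv using DERIV_const DERIV_unique by blast
qed

section \<open>The Gram matrix as a quadratic polynomial\<close>

text \<open>
  The entries of the Gram matrix \<open>v\<^sup>\<star>v\<close>, polarised: with two separate arguments the map is
  bilinear over the reals, so that it expands along any real linear combination of matrices.
\<close>

definition gram_entries :: "complex^'m^'n \<Rightarrow> complex^'m^'n \<Rightarrow> (real^'m^'m) \<times> (real^'m^'m)" where
  "gram_entries v w = entries (conj_transpose v ** w)"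

lemma bilinear_gram_entries: "bilinear (gram_entries :: complex^'m^'n \<Rightarrow> _)"
  unfolding bilinear_def
  by (auto intro!: linearI simp: gram_entries_def entries_def conj_transpose_def matrix_matrix_mult_def
      vec_eq_iff algebra_simps sum.distrib sum_distrib_left sum_subtractf)

text \<open>
  The index follows \<open>real_entry\<close>: the last component selects the direction of the real part
  or that of the imaginary part.
\<close>

definition unit_matrix :: "'n \<times> 'm \<times> bool \<Rightarrow> complex^'m^'n" where
  "unit_matrix = (\<lambda>(j, k, c). axis j (axis k (if c then 1 else \<i>)))"

lemma sum_triple_UNIV:
  "(\<Sum>e\<in>UNIV. g (e :: 'n::finite \<times> 'm::finite \<times> bool)) = (\<Sum>j\<in>UNIV. \<Sum>k\<in>UNIV. g (j, k, True) + g (j, k, False))"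
  unfolding UNIV_Times_UNIV[symmetric] sum.cartesian_product'
  by (simp add: UNIV_bool add.commute)

lemma matrix_eq_sum_unit_matrix:
  fixes w :: "complex^'m^'n"
  shows "w = (\<Sum>e\<in>UNIV. (case e of (j, k, c) \<Rightarrow> if c then Re (w $ j $ k) else Im (w $ j $ k)) *\<^sub>R unit_matrix e)"
proof -
  have "(Re (w $ j $ k) *\<^sub>R axis j (axis k 1) + Im (w $ j $ k) *\<^sub>R axis j (axis k \<i>)) $ p $ q =
      (if k = q then if j = p then w $ j $ k else 0 else 0)" for j p k q
    by (simp add: axis_def complex_eq_iff)
  then show ?thesis
    by (simp add: vec_eq_iff sum_triple_UNIV unit_matrix_def)
qed

lemma gram_entries_expansion:
  fixes b :: "complex^'m^'n" and E :: "'e::finite \<Rightarrow> complex^'m^'n"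
  shows "gram_entries (b + (\<Sum>e\<in>UNIV. u e *\<^sub>R E e)) (b + (\<Sum>e\<in>UNIV. u e *\<^sub>R E e)) =
    gram_entries b b + (\<Sum>i\<in>UNIV. u i *\<^sub>R (gram_entries b (E i) + gram_entries (E i) b)) +
    (\<Sum>i\<in>UNIV. \<Sum>j\<in>UNIV. (u i * u j) *\<^sub>R gram_entries (E i) (E j))"
proof -
  let ?g = "gram_entries :: complex^'m^'n \<Rightarrow> complex^'m^'n \<Rightarrow> (real^'m^'m) \<times> (real^'m^'m)"
  have l: "linear (?g v)" "linear (\<lambda>v. ?g v w)" for v w
    using bilinear_gram_entries by (auto simp: bilinear_def)
  have swap: "(\<Sum>i\<in>UNIV. \<Sum>j\<in>UNIV. (u i * u j) *\<^sub>R ?g (E j) (E i)) =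
      (\<Sum>i\<in>UNIV. \<Sum>j\<in>UNIV. (u i * u j) *\<^sub>R ?g (E i) (E j))"
    by (subst sum.swap) (simp only: mult.commute)
  show ?thesis
    by (simp add: linear_add[OF l(1)] linear_sum[OF l(1)] linear_cmul[OF l(1)]
        linear_add[OF l(2)] linear_sum[OF l(2)] linear_cmul[OF l(2)]
        scaleR_add_right sum.distrib scaleR_right.sum swap)
qed

definition x_unit :: "'m \<Rightarrow> 'm \<Rightarrow> (real^'m^'m) \<times> (real^'m^'m)" where
  "x_unit j k = (axis j (axis k 1), 0)"

definition y_unit :: "'m \<Rightarrow> 'm \<Rightarrow> (real^'m^'m) \<times> (real^'m^'m)" where
  "y_unit j k = (0, axis j (axis k 1))"

text \<open>
  The Hermitian matrix supported on row and column \<open>k\<close> whose column \<open>k\<close> is \<open>s + \<i> t\<close>, with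
  the diagonal entry replaced by \<open>2 s\<^sub>k\<close>. All first order terms \<open>L\<^sub>e\<close> have this shape.
\<close>

definition hermitian_cross :: "('m \<Rightarrow> real) \<Rightarrow> ('m \<Rightarrow> real) \<Rightarrow> 'm \<Rightarrow> (real^'m^'m) \<times> (real^'m^'m)" where
  "hermitian_cross s t k =
     (\<Sum>p\<in>UNIV. s p *\<^sub>R (x_unit p k + x_unit k p)) + (\<Sum>p\<in>UNIV. t p *\<^sub>R (y_unit p k - y_unit k p))"

lemma sum_axis_axis:
  fixes s :: "'m::finite \<Rightarrow> real"
  shows "(\<Sum>p\<in>UNIV. s p * (axis p (axis k 1) :: real^'m^'m) $ i $ j) = (if j = k then s i else 0)"
    and "(\<Sum>p\<in>UNIV. s p * (axis k (axis p 1) :: real^'m^'m) $ i $ j) = (if i = k then s j else 0)"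
proof -
  have "s p * (axis p (axis k 1) :: real^'m^'m) $ i $ j = (if p = i then if j = k then s p else 0 else 0)"
    "s p * (axis k (axis p 1) :: real^'m^'m) $ i $ j = (if p = j then if i = k then s p else 0 else 0)" for p
    by (auto simp: axis_def)
  then show "(\<Sum>p\<in>UNIV. s p * (axis p (axis k 1) :: real^'m^'m) $ i $ j) = (if j = k then s i else 0)"
    and "(\<Sum>p\<in>UNIV. s p * (axis k (axis p 1) :: real^'m^'m) $ i $ j) = (if i = k then s j else 0)"
    by simp_all
qed

lemma hermitian_cross_entries:
  "hermitian_cross s t k =
     ((\<chi> i j. (if j = k then s i else 0) + (if i = k then s j else 0)),
      (\<chi> i j. (if j = k then t i else 0) - (if i = k then t j else 0)))"
  by (simp add: hermitian_cross_def x_unit_def y_unit_def prod_eq_iff vec_eq_iff fst_sum snd_sum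
      algebra_simps sum.distrib sum_subtractf sum_axis_axis)

lemma gram_entries_axis:
  fixes b :: "complex^'m^'n" and k :: 'm
  shows "conj_transpose b ** axis j (axis k z) = (\<chi> p q. if q = k then cnj (b $ j $ p) * z else 0)"
    and "conj_transpose (axis j (axis k z)) ** b = (\<chi> p q. if p = k then cnj z * b $ j $ q else 0)"
proof -
  have "cnj (b $ l $ p) * (axis j (axis k z) :: complex^'m^'n) $ l $ q = (if l = j then if q = k then cnj (b $ l $ p) * z else 0 else 0)"
    "cnj ((axis j (axis k z) :: complex^'m^'n) $ l $ p) * b $ l $ q = (if l = j then if p = k then cnj z * b $ l $ q else 0 else 0)"
    for l p q
    by (auto simp: axis_def)
  then show "conj_transpose b ** axis j (axis k z) = (\<chi> p q. if q = k then cnj (b $ j $ p) * z else 0)"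
    and "conj_transpose (axis j (axis k z)) ** b = (\<chi> p q. if p = k then cnj z * b $ j $ q else 0)"
    by (simp_all add: conj_transpose_def matrix_matrix_mult_def vec_eq_iff)
qed

text \<open>
  Column \<open>k\<close> of \<open>b\<^sup>\<star>E\<^sub>e\<close> is the conjugate of row \<open>j\<close> of \<open>b\<close>, multiplied by \<open>\<i>\<close> for the imaginary
  direction, and the other columns vanish.
\<close>

lemma gram_entries_first_order:
  fixes b :: "complex^'m^'n"
  shows "gram_entries b (unit_matrix (j, k, True)) + gram_entries (unit_matrix (j, k, True)) b =
      hermitian_cross (\<lambda>p. Re (b $ j $ p)) (\<lambda>p. - Im (b $ j $ p)) k"
    and "gram_entries b (unit_matrix (j, k, False)) + gram_entries (unit_matrix (j, k, False)) b =
      hermitian_cross (\<lambda>p. Im (b $ j $ p)) (\<lambda>p. Re (b $ j $ p)) k"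
  by (auto simp: gram_entries_def unit_matrix_def gram_entries_axis hermitian_cross_entries entries_def
      prod_eq_iff vec_eq_iff)

lemma gram_entries_unit_matrix:
  fixes j :: "'n::finite" and k :: "'m::finite"
  shows "gram_entries (unit_matrix (j, k, c)) (unit_matrix (j, k, c) :: complex^'m^'n) = x_unit k k"
proof -
  have "conj_transpose (unit_matrix (j, k, c) :: complex^'m^'n) ** unit_matrix (j, k, c) =
      (\<chi> p q. if q = k then if p = k then 1 else 0 else 0)"
    unfolding unit_matrix_def prod.case gram_entries_axis(1) by (auto simp: vec_eq_iff axis_def)
  then show ?thesis
    by (auto simp: gram_entries_def entries_def x_unit_def prod_eq_iff vec_eq_iff axis_def)
qed

lemma gram_entries_diagonal:
  "fst (gram_entries b b) $ p $ q = (\<Sum>j\<in>UNIV. Re (b $ j $ p) * Re (b $ j $ q) + Im (b $ j $ p) * Im (b $ j $ q))"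
  "snd (gram_entries b b) $ p $ q = (\<Sum>j\<in>UNIV. Re (b $ j $ p) * Im (b $ j $ q) - Im (b $ j $ p) * Re (b $ j $ q))"
  by (simp_all add: gram_entries_def entries_def conj_transpose_def matrix_matrix_mult_def)

section \<open>Recognising the Laguerre operator\<close>

lemma partial_frechet_unit:
  assumes "C1_fun f"
  shows "partial_x j k f = (\<lambda>p. frechet_derivative f (at p) (x_unit j k))"
    and "partial_y j k f = (\<lambda>p. frechet_derivative f (at p) (y_unit j k))"
  using assms by (simp_all add: partial_x_frechet partial_y_frechet x_unit_def y_unit_def)

lemma second_partial_frechet_unit:
  assumes "C2_fun f"
  shows "partial_x i j (partial_x k l f) p = second_derivative f p (x_unit k l) (x_unit i j)"
    and "partial_x i j (partial_y k l f) p = second_derivative f p (y_unit k l) (x_unit i j)"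
    and "partial_y i j (partial_x k l f) p = second_derivative f p (x_unit k l) (y_unit i j)"
    and "partial_y i j (partial_y k l f) p = second_derivative f p (y_unit k l) (y_unit i j)"
proof -
  note f1 = C2_fun_imp_C1_fun(1)[OF assms] and D = C2_fun_imp_C1_fun(2)[OF assms]
  show "partial_x i j (partial_x k l f) p = second_derivative f p (x_unit k l) (x_unit i j)"
    "partial_x i j (partial_y k l f) p = second_derivative f p (y_unit k l) (x_unit i j)"
    "partial_y i j (partial_x k l f) p = second_derivative f p (x_unit k l) (y_unit i j)"
    "partial_y i j (partial_y k l f) p = second_derivative f p (y_unit k l) (y_unit i j)"
    by (simp_all add: partial_frechet_unit[OF f1] partial_frechet_unit[OF D] second_derivative_def)
qed

lemma hermitian_compatible_frechet:
  assumes "C1_fun f" "hermitian_compatible f"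
  shows "frechet_derivative f (at q) (x_unit j k) = frechet_derivative f (at q) (x_unit k j)"
    and "frechet_derivative f (at q) (y_unit j k) = - frechet_derivative f (at q) (y_unit k j)"
proof -
  have "partial_x j k f q = partial_x k j f q" "partial_y j k f q = - partial_y k j f q"
    using assms(2) unfolding hermitian_compatible_def by metis+
  then show "frechet_derivative f (at q) (x_unit j k) = frechet_derivative f (at q) (x_unit k j)"
    "frechet_derivative f (at q) (y_unit j k) = - frechet_derivative f (at q) (y_unit k j)"
    by (simp_all add: partial_frechet_unit[OF assms(1)])
qed

text \<open>
  The hypothesis on \<open>f\<close> passes at once to the inner derivative. For the outer one,
  \<open>x_unit j k - x_unit k j\<close> and \<open>y_unit j k + y_unit k j\<close> are directions along which the
  derivative of \<open>f\<close> vanishes identically.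
\<close>

lemma hermitian_compatible_second_derivative:
  assumes f: "C2_fun f" and herm: "hermitian_compatible f"
  shows "second_derivative f p (x_unit j k) v = second_derivative f p (x_unit k j) v"
    and "second_derivative f p (y_unit j k) v = - second_derivative f p (y_unit k j) v"
    and "second_derivative f p v (x_unit j k) = second_derivative f p v (x_unit k j)"
    and "second_derivative f p v (y_unit j k) = - second_derivative f p v (y_unit k j)"
proof -
  note f1 = C2_fun_imp_C1_fun(1)[OF f] and D = C2_fun_imp_C1_fun(2)[OF f]
  note H = hermitian_compatible_frechet[OF f1 herm]
  note bil = bilinear_second_derivative[OF f]
  note lin = C1_fun_linear[OF f1]
  show "second_derivative f p (x_unit j k) v = second_derivative f p (x_unit k j) v"
    by (simp add: second_derivative_def H(1)[of _ j k])
  show "second_derivative f p (y_unit j k) v = - second_derivative f p (y_unit k j) v"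
    by (simp add: second_derivative_def H(2)[of _ j k] C1_fun_uminus[OF D])
  have "second_derivative f p v (x_unit j k - x_unit k j) = 0"
    by (rule second_derivative_null_direction[OF f]) (simp add: linear_diff[OF lin] H(1)[of _ j k])
  then show "second_derivative f p v (x_unit j k) = second_derivative f p v (x_unit k j)"
    by (simp add: bilinear_rsub[OF bil])
  have "second_derivative f p v (y_unit j k + y_unit k j) = 0"
    by (rule second_derivative_null_direction[OF f]) (simp add: linear_add[OF lin] H(2)[of _ j k])
  then show "second_derivative f p v (y_unit j k) = - second_derivative f p v (y_unit k j)"
    by (simp add: bilinear_radd[OF bil])
qed

text \<open>
  By compatibility, differentiating along \<open>hermitian_cross s t k\<close> is twice differentiating along
  its column \<open>k\<close>; doing so in both arguments gives the factor \<open>4\<close>.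
\<close>

lemma second_derivative_hermitian_cross:
  fixes p :: "(real^'m^'m) \<times> (real^'m^'m)"
  assumes f: "C2_fun f" and herm: "hermitian_compatible f"
  defines "S \<equiv> second_derivative f p"
  shows "S (hermitian_cross s t k) (hermitian_cross s t k) =
    4 * (\<Sum>i\<in>UNIV. \<Sum>j\<in>UNIV.
      s i * s j * S (x_unit i k) (x_unit j k) + s i * t j * S (x_unit i k) (y_unit j k) +
      t i * s j * S (y_unit i k) (x_unit j k) + t i * t j * S (y_unit i k) (y_unit j k))"
proof -
  have bil: "bilinear S"
    unfolding S_def by (rule bilinear_second_derivative[OF f])
  note H = hermitian_compatible_second_derivative[OF f herm, of p, folded S_def]
  have l: "linear (S v)" "linear (\<lambda>v. S v w)" for v w
    using bil unfolding bilinear_def by blast+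
  have left: "S (hermitian_cross s t k) v = 2 * (\<Sum>i\<in>UNIV. s i * S (x_unit i k) v + t i * S (y_unit i k) v)" for v
    unfolding hermitian_cross_def linear_add[OF l(2)] linear_sum[OF l(2)] linear_cmul[OF l(2)] linear_diff[OF l(2)]
      H(1)[of k] H(2)[of k]
    by (simp add: sum_distrib_left sum.distrib distrib_left mult.left_commute)
  have right: "S v (hermitian_cross s t k) = 2 * (\<Sum>j\<in>UNIV. s j * S v (x_unit j k) + t j * S v (y_unit j k))" for v
    unfolding hermitian_cross_def linear_add[OF l(1)] linear_sum[OF l(1)] linear_cmul[OF l(1)] linear_diff[OF l(1)]
      H(3)[of _ k] H(4)[of _ k]
    by (simp add: sum_distrib_left sum.distrib distrib_left mult.left_commute)
  show ?thesis
    unfolding left unfolding right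
    by (simp add: sum_distrib_left sum.distrib distrib_left mult_ac)
qed

text \<open>
  For a fixed entry \<open>(j, k)\<close> of \<open>b\<close>, the real direction has the coefficients
  \<open>(\<alpha>, - \<beta>)\<close> and the imaginary direction \<open>(\<beta>, \<alpha>)\<close>, where \<open>\<alpha> + \<i> \<beta>\<close> is row \<open>j\<close> of \<open>b\<close>. Adding the
  two quadratic forms leaves only the combinations \<open>\<alpha>\<^sub>i \<alpha>\<^sub>l + \<beta>\<^sub>i \<beta>\<^sub>l\<close> and \<open>\<alpha>\<^sub>i \<beta>\<^sub>l - \<beta>\<^sub>i \<alpha>\<^sub>l\<close>,
  whose sums over \<open>j\<close> are the entries of \<open>x\<close> and \<open>y\<close>.
\<close>

lemma laguerre_operator_gram_entries:
  fixes b :: "complex^'m^'n" and f :: "(real^'m^'m) \<times> (real^'m^'m) \<Rightarrow> real"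
  assumes f: "C2_fun f" and herm: "hermitian_compatible f"
  defines "p \<equiv> gram_entries b b"
  defines "L \<equiv> \<lambda>e. gram_entries b (unit_matrix e) + gram_entries (unit_matrix e) b"
  shows "(\<Sum>e\<in>UNIV. frechet_derivative f (at p) (gram_entries (unit_matrix e) (unit_matrix e)) +
      second_derivative f p (L e) (L e) / 2) = laguerre_operator CARD('n) f p"
proof -
  let ?S = "second_derivative f p"
  define x where "x = fst p"
  define y where "y = snd p"
  have p: "p = (x, y)" by (simp add: x_def y_def)
  note H = hermitian_compatible_second_derivative[OF f herm, of p]
  have f1: "C1_fun f"
    using f by (simp add: C2_fun_def)
  have first: "(\<Sum>e\<in>(UNIV :: ('n \<times> 'm \<times> bool) set).
      frechet_derivative f (at p) (gram_entries (unit_matrix e) (unit_matrix e :: complex^'m^'n))) =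
      2 * real CARD('n) * trace (op_apply (re_op ddz) f p)"
    by (simp add: sum_triple_UNIV gram_entries_unit_matrix re_op_ddz trace_def op_apply_def ddx_def
        partial_frechet_unit[OF f1] flip: sum_distrib_left)
  \<comment> \<open>Transposing the inner indices, as in \<open>\<partial>/\<partial>y\<^sub>k\<^sub>i = - \<partial>/\<partial>y\<^sub>i\<^sub>k\<close>, turns the differences in the
    squared operator into the sum \<open>T\<close>, and the sum in its imaginary part into the difference \<open>T'\<close>.\<close>
  define T where "T i j k = ?S (x_unit i k) (x_unit j k) + ?S (y_unit i k) (y_unit j k)" for i j k
  define T' where "T' i j k = ?S (y_unit i k) (x_unit j k) - ?S (x_unit i k) (y_unit j k)" for i j k
  have tx: "trace (x ** op_apply (re_op (cop_mult ddz ddz)) f p) =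
      (\<Sum>i\<in>UNIV. \<Sum>j\<in>UNIV. \<Sum>k\<in>UNIV. x $ i $ j * T i j k)"
  proof -
    have "?S (x_unit k i) (x_unit j k) - ?S (y_unit k i) (y_unit j k) = T i j k" for i j k
      by (simp add: T_def H(1)[of k i] H(2)[of k i])
    then show ?thesis
      unfolding re_op_ddz_squared[OF f]
      by (simp add: trace_def matrix_matrix_mult_def op_apply_def op_add_def op_neg_def op_mult_def ddx_def ddy_def
          second_partial_frechet_unit[OF f] flip: sum_distrib_left sum_subtractf)
  qed
  have ty: "trace (y ** op_apply (im_op (cop_mult ddz ddz)) f p) =
      (\<Sum>i\<in>UNIV. \<Sum>j\<in>UNIV. \<Sum>k\<in>UNIV. y $ i $ j * T' i j k)"
  proof -
    have "- (?S (y_unit k i) (x_unit j k) + ?S (x_unit k i) (y_unit j k)) = T' i j k" for i j k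
      by (simp add: T'_def H(1)[of k i] H(2)[of k i])
    then show ?thesis
      unfolding im_op_ddz_squared[OF f]
      by (simp add: trace_def matrix_matrix_mult_def op_apply_def op_add_def op_neg_def op_mult_def ddx_def ddy_def
          second_partial_frechet_unit[OF f] flip: sum_distrib_left sum.distrib sum_negf)
  qed
  define \<alpha> where "\<alpha> j i = Re (b $ j $ i)" for j i
  define \<beta> where "\<beta> j i = Im (b $ j $ i)" for j i
  define F where "F j k i l = (\<alpha> j i * \<alpha> j l + \<beta> j i * \<beta> j l) * T i l k +
      (\<alpha> j i * \<beta> j l - \<beta> j i * \<alpha> j l) * T' i l k" for j k i l
  have LT: "L (j, k, True) = hermitian_cross (\<alpha> j) (\<lambda>i. - \<beta> j i) k"
    and LF: "L (j, k, False) = hermitian_cross (\<beta> j) (\<alpha> j) k" for j k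
    by (simp_all add: L_def gram_entries_first_order \<alpha>_def[abs_def] \<beta>_def[abs_def])
  have "?S (L (j, k, True)) (L (j, k, True)) / 2 + ?S (L (j, k, False)) (L (j, k, False)) / 2 =
      2 * (\<Sum>i\<in>UNIV. \<Sum>l\<in>UNIV. F j k i l)" for j k
  proof -
    define G where "G s t i l = s i * s l * ?S (x_unit i k) (x_unit l k) + s i * t l * ?S (x_unit i k) (y_unit l k) +
      t i * s l * ?S (y_unit i k) (x_unit l k) + t i * t l * ?S (y_unit i k) (y_unit l k)" for s t i l
    have cross: "?S (hermitian_cross s t k) (hermitian_cross s t k) = 4 * (\<Sum>i\<in>UNIV. \<Sum>l\<in>UNIV. G s t i l)" for s t
      unfolding G_def by (rule second_derivative_hermitian_cross[OF f herm])
    have "F j k i l = G (\<alpha> j) (\<lambda>i. - \<beta> j i) i l + G (\<beta> j) (\<alpha> j) i l" for i l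
      by (simp add: F_def T_def T'_def G_def algebra_simps)
    then show ?thesis
      unfolding LT LF cross by (simp add: sum.distrib)
  qed
  then have "(\<Sum>e\<in>(UNIV :: ('n \<times> 'm \<times> bool) set). ?S (L e) (L e) / 2) =
      2 * (\<Sum>j\<in>UNIV. \<Sum>k\<in>UNIV. \<Sum>i\<in>UNIV. \<Sum>l\<in>UNIV. F j k i l)"
    by (simp add: sum_triple_UNIV sum_distrib_left)
  also have "(\<Sum>j\<in>UNIV. \<Sum>k\<in>UNIV. \<Sum>i\<in>UNIV. \<Sum>l\<in>UNIV. F j k i l) =
      (\<Sum>i\<in>UNIV. \<Sum>l\<in>UNIV. \<Sum>k\<in>UNIV. \<Sum>j\<in>UNIV. F j k i l)"
    unfolding sum.cartesian_product
    by (rule sum.reindex_bij_witness[of _ "\<lambda>(i, l, k, j). (j, k, i, l)" "\<lambda>(j, k, i, l). (i, l, k, j)"]) auto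
  also have "\<dots> = (\<Sum>i\<in>UNIV. \<Sum>l\<in>UNIV. \<Sum>k\<in>UNIV. x $ i $ l * T i l k + y $ i $ l * T' i l k)"
  proof (intro sum.cong refl)
    fix i l k
    show "(\<Sum>j\<in>UNIV. F j k i l) = x $ i $ l * T i l k + y $ i $ l * T' i l k"
      unfolding x_def y_def p_def gram_entries_diagonal sum_distrib_right sum.distrib[symmetric] F_def \<alpha>_def \<beta>_def
      by (rule refl)
  qed
  also have "\<dots> = trace (x ** op_apply (re_op (cop_mult ddz ddz)) f p) +
      trace (y ** op_apply (im_op (cop_mult ddz ddz)) f p)"
    by (simp add: tx ty sum.distrib)
  finally have "(\<Sum>e\<in>(UNIV :: ('n \<times> 'm \<times> bool) set). ?S (L e) (L e) / 2) =
      2 * (trace (x ** op_apply (re_op (cop_mult ddz ddz)) f p) +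
        trace (y ** op_apply (im_op (cop_mult ddz ddz)) f p))" .
  with first show ?thesis
    unfolding sum.distrib by (simp add: laguerre_operator_def p)
qed

section \<open>Increments of a Brownian matrix\<close>

text \<open>
  The increment is a measurable function of the whole path, so independence of the entries as
  processes is inherited by the increments.
\<close>

lemma gaussian_vector_brownian_increments:
  assumes "complex_brownian_matrix M b B" and t: "0 < t"
  shows "gaussian_vector M t (\<lambda>e \<omega>. real_entry B e t \<omega> - real_entry B e 0 \<omega>)"
proof -
  interpret prob_space M
    using assms by (simp add: complex_brownian_matrix_def)
  let ?paths = "\<lambda>e \<omega>. restrict (\<lambda>t. real_entry B e t \<omega>) {0..}"
  have "indep_vars (\<lambda>_. Pi\<^sub>M {0..} (\<lambda>_. borel)) ?paths UNIV"
    using assms by (simp add: complex_brownian_matrix_def)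
  moreover have "(\<lambda>g. g t - g 0) \<in> borel_measurable (Pi\<^sub>M {0..} (\<lambda>_. borel :: real measure))"
    using t by (intro borel_measurable_diff measurable_component_singleton) auto
  ultimately have "indep_vars (\<lambda>_. borel) (\<lambda>e \<omega>. ?paths e \<omega> t - ?paths e \<omega> 0) UNIV"
    by (rule indep_vars_compose2)
  then have ind: "indep_vars (\<lambda>_. borel) (\<lambda>e \<omega>. real_entry B e t \<omega> - real_entry B e 0 \<omega>) UNIV"
    using t by simp
  have "brownian_motion M (Re (b $ j $ k)) (real_entry B (j, k, True))"
    "brownian_motion M (Im (b $ j $ k)) (real_entry B (j, k, False))" for j k
    using assms(1) unfolding complex_brownian_matrix_def by blast+
  then have "brownian_motion M (case e of (j, k, c) \<Rightarrow> if c then Re (b $ j $ k) else Im (b $ j $ k))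
      (real_entry B e)" for e
    by (cases e rule: prod_cases3) simp
  then have "\<forall>s t. 0 \<le> s \<longrightarrow> s < t \<longrightarrow> distributed M lborel
      (\<lambda>\<omega>. real_entry B e t \<omega> - real_entry B e s \<omega>) (normal_density 0 (sqrt (t - s)))" for e
    by (simp add: brownian_motion_def)
  from this[rule_format, of 0 t] t
  have "distributed M lborel (\<lambda>\<omega>. real_entry B e t \<omega> - real_entry B e 0 \<omega>) (normal_density 0 (sqrt t))" for e
    by simp
  with ind show ?thesis
    by (simp add: gaussian_vector_def)
qed

lemma brownian_matrix_AE_decomposition:
  fixes B :: "real \<Rightarrow> 'w \<Rightarrow> complex^'m^'n"
  assumes "complex_brownian_matrix M b B"
  shows "AE \<omega> in M. B t \<omega> = b + (\<Sum>e\<in>UNIV. (real_entry B e t \<omega> - real_entry B e 0 \<omega>) *\<^sub>R unit_matrix e)"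
proof -
  have "AE \<omega> in M. \<forall>j\<in>UNIV. \<forall>k\<in>UNIV. Re (B 0 \<omega> $ j $ k) = Re (b $ j $ k) \<and> Im (B 0 \<omega> $ j $ k) = Im (b $ j $ k)"
    using assms
    by (intro AE_finite_allI AE_conjI finite)
       (simp_all add: complex_brownian_matrix_def brownian_motion_def real_entry_def)
  then have "AE \<omega> in M. B 0 \<omega> = b"
    by eventually_elim (simp add: vec_eq_iff complex_eq_iff)
  then show ?thesis
  proof eventually_elim
    case (elim \<omega>)
    have "B s \<omega> = (\<Sum>e\<in>UNIV. real_entry B e s \<omega> *\<^sub>R unit_matrix e)" for s
      using matrix_eq_sum_unit_matrix[of "B s \<omega>"] by (simp add: real_entry_def case_prod_beta)
    from this[of t] this[of 0] elim show ?case
      by (simp add: scaleR_left_diff_distrib sum_subtractf)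
  qed
qed

section \<open>The generator of the Laguerre process\<close>

theorem proposition1:
  fixes M :: "'w measure"
    and B :: "real \<Rightarrow> 'w \<Rightarrow> complex^'m^'n"
    and X :: "real \<Rightarrow> 'w \<Rightarrow> complex^'m^'m"
    and x0 :: "complex^'m^'m"
    and f :: "(real^'m^'m) \<times> (real^'m^'m) \<Rightarrow> real"
  assumes "laguerre_process M B x0 X"
    and "C2_fun f"
    and "hermitian_compatible f"
    and "\<forall>\<^sub>F t in at_right 0. integrable M (\<lambda>\<omega>. f (entries (X t \<omega>)))"
  shows "has_generator_value M X x0 (\<lambda>Z. f (entries Z))
           (laguerre_operator CARD('n) f (entries x0))"
proof -
  note f = assms(2)
  \<comment> \<open>Here \<open>x0 = b\<^sup>\<star>b\<close>; the generator value turns out to depend on \<open>b\<close> through \<open>x0\<close> alone.\<close>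
  obtain b where B: "complex_brownian_matrix M b B" and x0: "entries x0 = gram_entries b b"
    and X: "\<And>t \<omega>. 0 \<le> t \<Longrightarrow> \<omega> \<in> space M \<Longrightarrow> entries (X t \<omega>) = gram_entries (B t \<omega>) (B t \<omega>)"
    using assms(1) by (auto simp: laguerre_process_def gram_entries_def)
  have M: "prob_space M"
    using B by (simp add: complex_brownian_matrix_def)
  define E where "E = (unit_matrix :: 'n \<times> 'm \<times> bool \<Rightarrow> complex^'m^'n)"
  define Y where "Y t e \<omega> = real_entry B e t \<omega> - real_entry B e 0 \<omega>" for t e \<omega>
  define L where "L e = gram_entries b (E e) + gram_entries (E e) b" for e
  define Q where "Q i j = gram_entries (E i) (E j)" for i j
  define h where "h u = f (entries x0 + (\<Sum>i\<in>UNIV. u i *\<^sub>R L i) + (\<Sum>i\<in>UNIV. \<Sum>j\<in>UNIV. (u i * u j) *\<^sub>R Q i j))" for u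
  have Y: "gaussian_vector M t (Y t)" if "0 < t" for t
    unfolding Y_def[abs_def] by (rule gaussian_vector_brownian_increments[OF B that])
  have fX: "AE \<omega> in M. f (entries (X t \<omega>)) = h (\<lambda>e. Y t e \<omega>)" if "0 < t" for t
    using brownian_matrix_AE_decomposition[OF B, of t] AE_space
  proof eventually_elim
    case (elim \<omega>)
    then have "entries (X t \<omega>) = gram_entries (b + (\<Sum>e\<in>UNIV. Y t e \<omega> *\<^sub>R E e)) (b + (\<Sum>e\<in>UNIV. Y t e \<omega> *\<^sub>R E e))"
      using X[of t \<omega>] that by (simp add: Y_def E_def)
    then show ?case
      by (simp add: h_def x0 L_def Q_def gram_entries_expansion)
  qed
  have f_measurable: "f \<in> borel_measurable borel"
    using f by (intro borel_measurable_continuous_onI)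
      (auto simp: C2_fun_def C1_fun_def continuous_on_eq_continuous_at intro: differentiable_imp_continuous_within)
  have h_measurable: "h \<in> borel_measurable (Pi\<^sub>M UNIV (\<lambda>_. borel))"
    unfolding h_def[abs_def] by (rule measurable_compose[OF _ f_measurable]) measurable
  have hY_measurable: "(\<lambda>\<omega>. h (\<lambda>e. Y t e \<omega>)) \<in> borel_measurable M" if "0 < t" for t
    using measurable_compose[OF gaussian_vector_measurable_PiM[OF Y[OF that]] h_measurable] .
  have pos: "\<forall>\<^sub>F t in at_right (0::real). 0 < t"
    by (rule eventually_at_right_less)
  have int: "\<forall>\<^sub>F t in at_right 0. integrable M (\<lambda>\<omega>. h (\<lambda>e. Y t e \<omega>))"
    using assms(4) pos
  proof eventually_elim
    case (elim t)
    from integrable_cong_AE_imp[OF elim(1) hY_measurable[OF elim(2)]] fX[OF elim(2)]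
    show ?case by (auto simp: eq_commute)
  qed
  have "((\<lambda>t. ((\<integral>\<omega>. h (\<lambda>e. Y t e \<omega>) \<partial>M) - f (entries x0)) / t) \<longlongrightarrow>
      (\<Sum>e\<in>UNIV. frechet_derivative f (at (entries x0)) (Q e e) +
        second_derivative f (entries x0) (L e) (L e) / 2)) (at_right 0)"
    by (rule gaussian_second_order_limit[OF M Y h_measurable int])
       (use C2_fun_quadratic_substitution[OF f] in \<open>simp_all add: h_def\<close>)
  also have "(\<Sum>e\<in>UNIV. frechet_derivative f (at (entries x0)) (Q e e) +
        second_derivative f (entries x0) (L e) (L e) / 2) = laguerre_operator CARD('n) f (entries x0)"
    unfolding x0 Q_def L_def E_def by (rule laguerre_operator_gram_entries[OF f assms(3)])
  finally have lim: "((\<lambda>t. ((\<integral>\<omega>. h (\<lambda>e. Y t e \<omega>) \<partial>M) - f (entries x0)) / t) \<longlongrightarrow>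
      laguerre_operator CARD('n) f (entries x0)) (at_right 0)" .
  have "\<forall>\<^sub>F t in at_right 0. ((\<integral>\<omega>. h (\<lambda>e. Y t e \<omega>) \<partial>M) - f (entries x0)) / t =
      ((\<integral>\<omega>. f (entries (X t \<omega>)) \<partial>M) - f (entries x0)) / t"
    using assms(4) pos
  proof eventually_elim
    case (elim t)
    have "(\<integral>\<omega>. h (\<lambda>e. Y t e \<omega>) \<partial>M) = (\<integral>\<omega>. f (entries (X t \<omega>)) \<partial>M)"
      using hY_measurable[OF elim(2)] borel_measurable_integrable[OF elim(1)] fX[OF elim(2)]
      by (intro integral_cong_AE) (auto simp: eq_commute)
    then show ?case by simp
  qed
  with lim have "((\<lambda>t. ((\<integral>\<omega>. f (entries (X t \<omega>)) \<partial>M) - f (entries x0)) / t) \<longlongrightarrow>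
      laguerre_operator CARD('n) f (entries x0)) (at_right 0)"
    by (rule Lim_transform_eventually)
  with assms(4) show ?thesis
    by (simp add: has_generator_value_def)
qed

end
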